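(* Let $1\le p\le n$ and let $E=\begin{bmatrix} I_p\\ 0\end{bmatrix}\in \mathrm{St}(n,p)$. There is a (relatively) open, path-connected neighborhood $\mathcal{B}\subset \mathrm{St}(n,p)$ of $E$ such that the map $$ \psi_E:\ \mathcal{B}\to T_E\mathrm{St}(n,p)\cong \mathrm{skew}(p)\times\mathbb{R}^{(n-p)\times p}\cong \mathbb{R}^{\frac{p}{2}(p-1)+(n-p)p},\qquad U=\begin{bmatrix} U_1\\ U_2\end{bmatrix}\mapsto \begin{bmatrix}\log_m\!\left(U_1(U_1^TU_1)^{-\frac12}\right)\\ U_2(U_1^TU_1)^{-\frac12}\end{bmatrix}=:\begin{bmatrix}A\\ B\end{bmatrix} $$ is well defined and is a coordinate chart of $\mathrm{St}(n,p)$ on $\mathcal{B}$.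
   Context: $\mathrm{St}(n,p)=\{U\in\mathbb{R}^{n\times p}\mid U^TU=I_p\}$ is the Stiefel manifold, $I_p$ is the $p\times p$ identity matrix, and $\mathrm{skew}(p)$ is the space of real skew-symmetric $p\times p$ matrices. A matrix $U\in \mathrm{St}(n,p)$ is split into blocks $U=\begin{bmatrix} U_1\\ U_2\end{bmatrix}$ with $U_1\in\mathbb{R}^{p\times p}$ and $U_2\in\mathbb{R}^{(n-p)\times p}$. The tangent space at $E$ is $T_E\mathrm{St}(n,p)=\left\{\begin{bmatrix} A\\ B\end{bmatrix}\mid A\in\mathrm{skew}(p),\ B\in\mathbb{R}^{(n-p)\times p}\right\}$. $(\cdot)^{-\frac12}$ denotes the inverse of the symmetric positive definite square root of a symmetric positive definite matrix. $\log_m$ is the principal matrix logarithm, which is defined on the matrices in $SO(p)$ that do not have $-1$ as an eigenvalue and takes skew-symmetric values there. *)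

theory Defs
  imports "HOL-Analysis.Analysis"
begin

section \<open>Matrix functions\<close>

definition skew_matrix :: "real^'p^'p \<Rightarrow> bool" where
  "skew_matrix A \<longleftrightarrow> transpose A = - A"

definition pos_def_matrix :: "real^'p^'p \<Rightarrow> bool" where
  "pos_def_matrix M \<longleftrightarrow> transpose M = M \<and> (\<forall>x. x \<noteq> 0 \<longrightarrow> 0 < x \<bullet> (M *v x))"

definition spd_sqrt :: "real^'p^'p \<Rightarrow> real^'p^'p" where
  "spd_sqrt M = (THE S. pos_def_matrix S \<and> S ** S = M)"

definition spd_inv_sqrt :: "real^'p^'p \<Rightarrow> real^'p^'p" where
  "spd_inv_sqrt M = matrix_inv (spd_sqrt M)"

text \<open>Complex eigenvalues of a real matrix.\<close>

definition eigenvalues :: "real^'p^'p \<Rightarrow> complex set" where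
  "eigenvalues A =
     {c. \<exists>v :: complex^'p. v \<noteq> 0 \<and> (\<chi> i j. complex_of_real (A $ i $ j)) *v v = c *s v}"

text \<open>The multiplication of the type \<open>real^'p^'p\<close> is componentwise, so the library's
  \<^const>\<open>power\<close> and \<^const>\<open>exp\<close> are not the matrix power and exponential.\<close>

definition mat_power :: "real^'p^'p \<Rightarrow> nat \<Rightarrow> real^'p^'p" where
  "mat_power A k = (((**) A) ^^ k) (mat 1)"

definition mat_exp :: "real^'p^'p \<Rightarrow> real^'p^'p" where
  "mat_exp A = (\<Sum>k. (1 / fact k) *\<^sub>R mat_power A k)"

text \<open>The principal logarithm is the unique logarithm all of whose eigenvalues lie in the open
  strip of imaginary parts between \<open>-\<pi>\<close> and \<open>\<pi>\<close>. No skew-symmetry is imposed.\<close>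

definition mat_log :: "real^'p^'p \<Rightarrow> real^'p^'p" where
  "mat_log R = (THE X. mat_exp X = R \<and> (\<forall>c \<in> eigenvalues X. - pi < Im c \<and> Im c < pi))"

definition mat_log_domain :: "(real^'p^'p) set" where
  "mat_log_domain = {R. rotation_matrix R \<and> - 1 \<notin> eigenvalues R}"


section \<open>The Stiefel manifold and its block decomposition\<close>

definition stiefel :: "(real^'p^'n) set" where
  "stiefel = {U. transpose U ** U = mat 1}"

text \<open>An injection \<open>\<iota> :: 'p \<Rightarrow> 'n\<close> of column indices into row indices designates the rows of the
  upper \<open>p \<times> p\<close> block. The usual block form is the special case in which
  \<open>\<iota>\<close> enumerates the first \<open>p\<close> rows. As index types are nonempty and \<open>n = p\<close> is to be allowed,
  an \<open>(n - p) \<times> p\<close> matrix is represented by an \<open>n \<times> p\<close> matrix of which only the rows outside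
  \<open>range \<iota>\<close> are relevant.\<close>

definition upper_block :: "('p \<Rightarrow> 'n) \<Rightarrow> real^'p^'n \<Rightarrow> real^'p^'p" where
  "upper_block \<iota> U = (\<chi> i. U $ \<iota> i)"

definition lower_block :: "('p \<Rightarrow> 'n) \<Rightarrow> real^'p^'n \<Rightarrow> real^'p^'n" where
  "lower_block \<iota> U = (\<chi> i. if i \<in> range \<iota> then 0 else U $ i)"

definition stack_blocks :: "('p \<Rightarrow> 'n) \<Rightarrow> real^'p^'p \<Rightarrow> real^'p^'n \<Rightarrow> real^'p^'n" where
  "stack_blocks \<iota> A B = (\<chi> i. if i \<in> range \<iota> then A $ inv \<iota> i else B $ i)"

definition base_point :: "('p \<Rightarrow> 'n) \<Rightarrow> real^'p^'n" where
  "base_point \<iota> = stack_blocks \<iota> (mat 1) 0"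

definition tangent_space_E :: "('p \<Rightarrow> 'n) \<Rightarrow> (real^'p^'n) set" where
  "tangent_space_E \<iota> = {stack_blocks \<iota> A B | A B. skew_matrix A}"

definition gram_inv_sqrt :: "('p \<Rightarrow> 'n) \<Rightarrow> real^'p^'n \<Rightarrow> real^'p^'p" where
  "gram_inv_sqrt \<iota> U = spd_inv_sqrt (transpose (upper_block \<iota> U) ** upper_block \<iota> U)"

definition psi_E :: "('p \<Rightarrow> 'n) \<Rightarrow> real^'p^'n \<Rightarrow> real^'p^'n" where
  "psi_E \<iota> U = stack_blocks \<iota>
     (mat_log (upper_block \<iota> U ** gram_inv_sqrt \<iota> U))
     (lower_block \<iota> U ** gram_inv_sqrt \<iota> U)"

text \<open>\<open>psi_E \<iota> U\<close> is well defined: the arguments of the inverse square root and of the logarithm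
  lie in the domains of these functions.\<close>

definition psi_E_defined :: "('p \<Rightarrow> 'n) \<Rightarrow> real^'p^'n \<Rightarrow> bool" where
  "psi_E_defined \<iota> U \<longleftrightarrow>
     pos_def_matrix (transpose (upper_block \<iota> U) ** upper_block \<iota> U) \<and>
     upper_block \<iota> U ** gram_inv_sqrt \<iota> U \<in> mat_log_domain"


section \<open>Coordinate charts of embedded submanifolds\<close>

text \<open>\<open>Ck_on k S f\<close> is the usual \<open>C\<^sup>k\<close> property for open \<open>S\<close>: all directional derivatives are
  again \<open>C\<^bsup>k-1\<^esup>\<close>.\<close>

primrec Ck_on :: "nat \<Rightarrow> 'a::euclidean_space set \<Rightarrow> ('a \<Rightarrow> 'b::euclidean_space) \<Rightarrow> bool" where
  "Ck_on 0 S f \<longleftrightarrow> continuous_on S f"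
| "Ck_on (Suc k) S f \<longleftrightarrow>
     (\<forall>x\<in>S. f differentiable (at x)) \<and>
     (\<forall>v. Ck_on k S (\<lambda>x. frechet_derivative f (at x) v))"

text \<open>On an arbitrary subset of a Euclidean space, smooth means locally extendable to a
  \<open>C\<^sup>\<infinity>\<close> map on an open subset of the ambient space.\<close>

definition smooth_map_on :: "'a::euclidean_space set \<Rightarrow> ('a \<Rightarrow> 'b::euclidean_space) \<Rightarrow> bool" where
  "smooth_map_on S f \<longleftrightarrow>
     (\<forall>x\<in>S. \<exists>W g. open W \<and> x \<in> W \<and> (\<forall>k. Ck_on k W g) \<and> (\<forall>y \<in> S \<inter> W. g y = f y))"

text \<open>A coordinate chart of an embedded submanifold \<open>M\<close> is a diffeomorphism from a relatively open
  subset \<open>B\<close> of \<open>M\<close> onto an open subset of a finite-dimensional real vector space, here a linear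
  subspace \<open>V\<close> of a Euclidean space. Any linear isomorphism between \<open>V\<close> and \<open>\<real>\<^sup>d\<close>, where
  \<open>d = dim V\<close>, turns it into a chart with values in \<open>\<real>\<^sup>d\<close>.\<close>

definition coordinate_chart ::
  "'a::euclidean_space set \<Rightarrow> 'b::euclidean_space set \<Rightarrow> 'a set \<Rightarrow> ('a \<Rightarrow> 'b) \<Rightarrow> bool" where
  "coordinate_chart M V B \<phi> \<longleftrightarrow>
     openin (top_of_set M) B \<and>
     subspace V \<and>
     openin (top_of_set V) (\<phi> ` B) \<and>
     inj_on \<phi> B \<and>
     smooth_map_on B \<phi> \<and>
     smooth_map_on (\<phi> ` B) (inv_into B \<phi>)"

end

theory Submission
  imports Defs "HOL-Computational_Algebra.Fundamental_Theorem_Algebra"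
begin

text \<open>The chart has an explicit inverse. For a skew-symmetric \<open>A\<close> and an arbitrary \<open>B\<close>, put
  \<open>U\<^sub>1 = exp(A) (I + B\<^sup>T B)\<^bsup>-1/2\<^esup>\<close> and \<open>U\<^sub>2 = B (I + B\<^sup>T B)\<^bsup>-1/2\<^esup>\<close>. Then
  \<open>U\<^sub>1\<^sup>T U\<^sub>1 = (I + B\<^sup>T B)\<^bsup>-1\<^esup>\<close>, so that \<open>U\<close> lies on the Stiefel manifold and
  \<open>U\<^sub>1 (U\<^sub>1\<^sup>T U\<^sub>1)\<^bsup>-1/2\<^esup> = exp(A)\<close>, \<open>U\<^sub>2 (U\<^sub>1\<^sup>T U\<^sub>1)\<^bsup>-1/2\<^esup> = B\<close>. Conversely, if \<open>U\<^sup>T U = I\<close> and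
  \<open>B = U\<^sub>2 (U\<^sub>1\<^sup>T U\<^sub>1)\<^bsup>-1/2\<^esup>\<close>, then \<open>I + B\<^sup>T B = (U\<^sub>1\<^sup>T U\<^sub>1)\<^bsup>-1\<^esup>\<close>, which inverts the formulas in the other
  direction. Hence \<open>\<psi>\<close> and this map are mutually inverse between a small ball \<open>D\<close> around \<open>0\<close> in the
  tangent space and a neighbourhood of \<open>E\<close>. This neighbourhood is path-connected because it is
  a continuous image of the convex set \<open>D\<close>.

  Everything happens near \<open>E\<close>, where \<open>U\<^sub>1\<^sup>T U\<^sub>1\<close>, the orthogonal polar factor
  \<open>U\<^sub>1 (U\<^sub>1\<^sup>T U\<^sub>1)\<^bsup>-1/2\<^esup>\<close> and \<open>I + B\<^sup>T B\<close> are all close to \<open>I\<close>. There the inverse square root and the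
  logarithm are given by the binomial and the logarithmic series, and such series are smooth
  (\<open>Ck_on_power_series\<close>). This provides smooth extensions of both maps to open subsets of the
  ambient space. It remains to identify the series with the functions defined by uniqueness.
  For the square root this is the uniqueness of positive definite square roots
  (\<open>pos_def_sqrt_unique\<close>). For the logarithm, a competitor \<open>X\<close> with \<open>exp X = R\<close> commutes with \<open>R\<close>,
  hence with the series \<open>A\<close> in \<open>R - I\<close>, and so \<open>exp(X - A) = I\<close>. If \<open>X \<noteq> A\<close>, then a common complex
  eigenvector of \<open>X\<close> and \<open>A\<close> shows that two of their eigenvalues differ by a nonzero multiple of
  \<open>2\<pi>i\<close>, which is impossible in the strip \<open>\<bar>Im c\<bar> < \<pi>\<close> (\<open>commuting_logarithms_eq\<close>).

  Power series are treated in an abstract Banach algebra. Square matrices are transported to the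
  algebra of endomorphisms of \<open>\<real>\<^sup>p\<close> with the operator norm, because the multiplication and the
  norm of the type \<open>real^'p^'p\<close> do not make it a normed algebra with unit of norm 1 under the
  matrix product.\<close>

section \<open>Power series in a Banach algebra\<close>

definition power_series :: "(nat \<Rightarrow> real) \<Rightarrow> 'a::{real_normed_algebra_1,banach} \<Rightarrow> 'a" where
  "power_series c y = (\<Sum>n. c n *\<^sub>R y ^ n)"

definition converges_below :: "real \<Rightarrow> (nat \<Rightarrow> real) \<Rightarrow> bool" where
  "converges_below K c \<longleftrightarrow> (\<forall>r. 0 \<le> r \<and> r < K \<longrightarrow> summable (\<lambda>n. \<bar>c n\<bar> * r ^ n))"

lemma summable_norm_power_series:
  fixes y :: "'a::{real_normed_algebra_1,banach}"
  assumes "converges_below K c" "norm y < K"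
  shows "summable (\<lambda>n. norm (c n *\<^sub>R y ^ n))"
proof (rule summable_comparison_test)
  show "summable (\<lambda>n. \<bar>c n\<bar> * norm y ^ n)"
    using assms by (simp add: converges_below_def)
  show "\<exists>N. \<forall>n\<ge>N. norm (norm (c n *\<^sub>R y ^ n)) \<le> \<bar>c n\<bar> * norm y ^ n"
    by (auto intro!: mult_left_mono norm_power_ineq)
qed

lemma power_series_sums:
  fixes y :: "'a::{real_normed_algebra_1,banach}"
  assumes "converges_below K c" "norm y < K"
  shows "(\<lambda>n. c n *\<^sub>R y ^ n) sums power_series c y"
  unfolding power_series_def
  by (rule summable_sums[OF summable_norm_cancel[OF summable_norm_power_series[OF assms]]])

lemma power_series_mult:
  fixes y :: "'a::{real_normed_algebra_1,banach}"
  assumes "converges_below K c" "converges_below K d" "norm y < K"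
  shows "power_series c y * power_series d y = power_series (\<lambda>n. \<Sum>i\<le>n. c i * d (n - i)) y"
proof -
  have "c i *\<^sub>R y ^ i * d (k - i) *\<^sub>R y ^ (k - i) = (c i * d (k - i)) *\<^sub>R y ^ k" if "i \<le> k" for i k
    using that by (simp add: power_add[symmetric] mult.commute)
  then have "(\<Sum>i\<le>k. c i *\<^sub>R y ^ i * d (k - i) *\<^sub>R y ^ (k - i)) = (\<Sum>i\<le>k. c i * d (k - i)) *\<^sub>R y ^ k" for k
    by (simp add: scaleR_sum_left)
  then show ?thesis
    unfolding power_series_def
    by (subst Cauchy_product[OF summable_norm_power_series[OF assms(1,3)] summable_norm_power_series[OF assms(2,3)]])
       (simp only:)
qed

lemma power_series_zero [simp]: "power_series c 0 = c 0 *\<^sub>R 1"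
  unfolding power_series_def
  by (subst suminf_finite[of "{0}"]) (auto simp: power_0_left)

text \<open>The coefficients of a termwise derivative: differentiation does not shrink the radius of
  convergence.\<close>

lemma converges_below_diffs:
  assumes "converges_below K c"
  shows "converges_below K (diffs (\<lambda>n. \<bar>c n\<bar>))"
proof -
  have "summable (\<lambda>n. diffs (\<lambda>n. \<bar>c n\<bar>) n * r ^ n)" if "0 \<le> r" "r < K" for r
  proof (rule termdiff_converges[of r K])
    fix x :: real assume "norm x < K"
    then have "summable (\<lambda>n. \<bar>c n\<bar> * \<bar>x\<bar> ^ n)"
      using assms by (simp add: converges_below_def)
    then show "summable (\<lambda>n. \<bar>c n\<bar> * x ^ n)"
      by (intro summable_norm_cancel[of "\<lambda>n. \<bar>c n\<bar> * x ^ n"]) (simp add: abs_mult power_abs)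
  qed (use that in auto)
  then show ?thesis
    unfolding converges_below_def by (simp add: diffs_def abs_mult)
qed

lemma converges_below_exp: "converges_below K (\<lambda>n. inverse (fact n))"
  unfolding converges_below_def
  using summable_exp[where 'a=real] by simp

lemma converges_below_gbinomial: "converges_below 1 (\<lambda>n. a gchoose n)"
  unfolding converges_below_def
proof safe
  fix r :: real assume r: "0 \<le> r" "r < 1"
  have "summable (\<lambda>n. norm ((a gchoose n) * r ^ n))"
    by (rule powser_insidea[OF summable_gbinomial[of "(r+1)/2"]]) (use r in auto)
  with r show "summable (\<lambda>n. \<bar>a gchoose n\<bar> * r ^ n)"
    by (simp add: abs_mult)
qed

definition binomial_series :: "real \<Rightarrow> 'a::{real_normed_algebra_1,banach} \<Rightarrow> 'a" where
  "binomial_series a = power_series (\<lambda>n. a gchoose n)"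

text \<open>The law of exponents is the Vandermonde identity read off from the Cauchy product. It makes
  the series with exponents \<open>1/2\<close> and \<open>-1/2\<close> a square root of \<open>1 + y\<close> and its inverse.\<close>

lemma binomial_series_mult:
  assumes "norm y < 1"
  shows "binomial_series a y * binomial_series b y = binomial_series (a + b) y"
  unfolding binomial_series_def
  by (subst power_series_mult[OF converges_below_gbinomial converges_below_gbinomial assms])
     (simp only: gbinomial_Vandermonde atLeast0AtMost[symmetric])

lemma binomial_series_exponent_0 [simp]: "binomial_series 0 y = 1"
  unfolding binomial_series_def power_series_def
  by (subst suminf_finite[of "{0}"]) (auto simp: gbinomial_0_left)

lemma binomial_series_exponent_1 [simp]: "binomial_series 1 y = 1 + y"
proof -
  have "(1::real) gchoose n = 0" if "n \<notin> {0,1}" for n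
    using that gbinomial_of_nat_symmetric[of n 1] binomial_gbinomial[of 1 n, where 'a=real]
    by (simp add: binomial_eq_0)
  then show ?thesis
    unfolding binomial_series_def power_series_def
    by (subst suminf_finite[of "{0,1}"]) auto
qed

lemma binomial_series_zero [simp]: "binomial_series a 0 = 1"
  by (simp add: binomial_series_def)

definition log_series :: "'a::{real_normed_algebra_1,banach} \<Rightarrow> 'a" where
  "log_series = power_series (\<lambda>n. (- 1) ^ Suc n / of_nat n)"

lemma converges_below_log: "converges_below 1 (\<lambda>n. (- 1) ^ Suc n / of_nat n)"
  unfolding converges_below_def
proof safe
  fix r :: real assume r: "0 \<le> r" "r < 1"
  show "summable (\<lambda>n. \<bar>(- 1) ^ Suc n / of_nat n\<bar> * r ^ n)"
  proof (rule summable_comparison_test)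
    show "summable (\<lambda>n. r ^ n)" using r by (simp add: summable_geometric)
    have "norm (\<bar>(- 1) ^ Suc n / real n\<bar> * r ^ n) \<le> 1 * r ^ n" for n
      using r mult_right_mono[of 1 "real n" "r ^ n"]
      by (cases "n = 0") (auto simp: abs_mult power_abs field_simps)
    then show "\<exists>N. \<forall>n\<ge>N. norm (\<bar>(- 1) ^ Suc n / real n\<bar> * r ^ n) \<le> r ^ n"
      by simp
  qed
qed

lemma log_series_zero [simp]: "log_series 0 = 0"
  by (simp add: log_series_def)

text \<open>The terms of degree at least 2 of the exponential have Lipschitz constant \<open>exp r - 1\<close> on the ball
  of radius \<open>r\<close>, by \<open>\<parallel>a\<^sup>n - b\<^sup>n\<parallel> \<le> n r\<^bsup>n-1\<^esup> \<parallel>a - b\<parallel>\<close>. As long as this constant is below 1, the linear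
  term dominates and the exponential is injective.\<close>

lemma exp_minus_id_lipschitz:
  fixes a b :: "'a::{real_normed_algebra_1,banach}"
  assumes "norm a \<le> r" "norm b \<le> r"
  shows "norm (exp a - exp b - (a - b)) \<le> (exp r - 1) * norm (a - b)"
proof -
  have r: "0 \<le> r" using assms(1) norm_ge_zero order_trans by blast
  have pow: "norm (a ^ Suc n - b ^ Suc n) \<le> real (Suc n) * r ^ n * norm (a - b)" for n
  proof (induction n)
    case (Suc n)
    have "a ^ Suc (Suc n) - b ^ Suc (Suc n) = a * (a ^ Suc n - b ^ Suc n) + (a - b) * b ^ Suc n"
      by (simp add: algebra_simps)
    also have "norm \<dots> \<le> norm a * norm (a ^ Suc n - b ^ Suc n) + norm (a - b) * norm (b ^ Suc n)"
      by (intro norm_triangle_le add_mono norm_mult_ineq)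
    also have "\<dots> \<le> r * (real (Suc n) * r ^ n * norm (a - b)) + norm (a - b) * r ^ Suc n"
      using assms r by (intro add_mono mult_mono Suc.IH order_trans[OF norm_power_ineq] power_mono) auto
    finally show ?case by (simp add: algebra_simps)
  qed simp
  let ?f = "\<lambda>n. (a ^ n - b ^ n) /\<^sub>R fact n"
  have sums: "?f sums (exp a - exp b)"
    unfolding scaleR_right_diff_distrib exp_def
    by (intro sums_diff summable_sums summable_exp_generic)
  have "(\<lambda>n. ?f (Suc (Suc n))) sums (exp a - exp b - (a - b))"
    using sums sums_Suc_iff[of ?f] sums_Suc_iff[of "\<lambda>n. ?f (Suc n)"] by simp
  then have eq: "exp a - exp b - (a - b) = (\<Sum>n. ?f (Suc (Suc n)))"
    by (rule sums_unique)
  let ?g = "\<lambda>n. r ^ n /\<^sub>R fact n"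
  have "?g sums exp r" using exp_converges[of r] by simp
  then have g: "(\<lambda>n. ?g (Suc n)) sums (exp r - 1)"
    using sums_Suc_iff[of ?g] by simp
  then have g: "(\<lambda>n. ?g (Suc n) * norm (a - b)) sums ((exp r - 1) * norm (a - b))"
    by (rule sums_mult2)
  have "norm (?f (Suc (Suc n))) \<le> ?g (Suc n) * norm (a - b)" for n
  proof -
    have "norm (?f (Suc (Suc n))) \<le> (real (Suc (Suc n)) * r ^ Suc n * norm (a - b)) /\<^sub>R fact (Suc (Suc n))"
      unfolding norm_scaleR using pow[of "Suc n"]
      by (auto simp del: power_Suc of_nat_Suc fact_Suc intro!: mult_left_mono)
    also have "\<dots> = ?g (Suc n) * norm (a - b)"
      by (simp add: field_simps del: of_nat_Suc)
    finally show ?thesis .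
  qed
  then have "norm (\<Sum>n. ?f (Suc (Suc n))) \<le> (\<Sum>n. ?g (Suc n) * norm (a - b))"
    by (intro norm_suminf_le) (use g in \<open>auto simp: sums_iff\<close>)
  also have "\<dots> = (exp r - 1) * norm (a - b)"
    using g by (simp add: sums_iff)
  finally show ?thesis by (simp only: eq)
qed

lemma exp_half_less_2: "exp (1/2::real) < 2"
proof -
  have "exp (1/2::real) ^ 2 = exp 1" by (simp add: power2_eq_square exp_add[symmetric])
  also have "\<dots> < 2 ^ 2" using exp_le by simp
  finally show ?thesis by (rule power_less_imp_less_base) simp
qed

lemma exp_inj_near_0:
  fixes a b :: "'a::{real_normed_algebra_1,banach}"
  assumes "exp a = exp b" "norm a \<le> 1/2" "norm b \<le> 1/2"
  shows "a = b"
proof (rule ccontr)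
  assume "a \<noteq> b"
  then have "(exp (1/2::real) - 1) * norm (a - b) < 1 * norm (a - b)"
    using exp_half_less_2 by (intro mult_strict_right_mono) auto
  moreover have "norm (exp a - exp b - (a - b)) = norm (a - b)"
    using assms by (simp add: norm_minus_commute)
  ultimately show False
    using exp_minus_id_lipschitz[OF assms(2,3)] by simp
qed

section \<open>Differentiating noncommutative power series\<close>

text \<open>Directional derivatives of \<open>x\<^sup>n\<close> are sums of words such as \<open>x v x x w\<close> in which the variable is
  mixed with constants. \<open>homogeneous m n c f\<close> says that \<open>f\<close> is a sum of words of degree \<open>n\<close> in the
  variable \<open>m x\<close>, and that replacing every letter by its norm bounds it by \<open>c \<parallel>m x\<parallel>\<^sup>n\<close>.
  Remembering the bound makes the class of convergent series of such terms closed under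
  directional derivatives. The linear map \<open>m\<close> lets the variable range over another space.\<close>

inductive homogeneous :: "('e::real_normed_vector \<Rightarrow> 'a::{real_normed_algebra_1,banach}) \<Rightarrow> nat \<Rightarrow> real \<Rightarrow> ('e \<Rightarrow> 'a) \<Rightarrow> bool"
  for m where
  const: "homogeneous m 0 (norm a) (\<lambda>_. a)"
| times_var: "homogeneous m n c f \<Longrightarrow> homogeneous m (Suc n) c (\<lambda>x. f x * m x)"
| times_const: "homogeneous m n c f \<Longrightarrow> homogeneous m n (c * norm a) (\<lambda>x. f x * a)"
| add: "homogeneous m n c f \<Longrightarrow> homogeneous m n d g \<Longrightarrow> homogeneous m n (c + d) (\<lambda>x. f x + g x)"

lemma homogeneous_nonneg: "homogeneous m n c f \<Longrightarrow> 0 \<le> c"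
  by (induction rule: homogeneous.induct) auto

lemma homogeneous_bound:
  assumes "homogeneous m n c f"
  shows "norm (f x) \<le> c * norm (m x) ^ n"
  using assms
proof (induction rule: homogeneous.induct)
  case (times_var n c f)
  have "norm (f x * m x) \<le> norm (f x) * norm (m x)" by (rule norm_mult_ineq)
  also have "\<dots> \<le> (c * norm (m x) ^ n) * norm (m x)"
    by (intro mult_right_mono times_var.IH) auto
  finally show ?case by (simp add: algebra_simps)
next
  case (times_const n c f a)
  have "norm (f x * a) \<le> norm (f x) * norm a" by (rule norm_mult_ineq)
  also have "\<dots> \<le> (c * norm (m x) ^ n) * norm a"
    by (intro mult_right_mono times_const.IH) auto
  finally show ?case by (simp add: algebra_simps)
next
  case (add n c f d g)
  then show ?case by (auto simp: algebra_simps intro: norm_triangle_le)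
qed simp

text \<open>By the Leibniz rule each of the \<open>n\<close> occurrences of the variable is replaced by the direction
  \<open>m v\<close> once, hence the factor \<open>n\<close> in the bound.\<close>

lemma homogeneous_derivative:
  assumes "homogeneous m n c f" and m: "bounded_linear m"
  shows "\<exists>f'. (\<forall>x. (f has_derivative f' x) (at x)) \<and> (n = 0 \<longrightarrow> f' = (\<lambda>_ _. 0)) \<and>
           (\<forall>k v. n = Suc k \<longrightarrow> homogeneous m k (real n * c * norm (m v)) (\<lambda>x. f' x v))"
  using assms(1)
proof (induction rule: homogeneous.induct)
  case (const a)
  then show ?case by (intro exI[of _ "\<lambda>_ _. 0"]) auto
next
  case (times_var n c f)
  then obtain f' where f': "\<And>x. (f has_derivative f' x) (at x)" "n = 0 \<Longrightarrow> f' = (\<lambda>_ _. 0)"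
    "\<And>k v. n = Suc k \<Longrightarrow> homogeneous m k (real n * c * norm (m v)) (\<lambda>x. f' x v)" by metis
  have "((\<lambda>x. f x * m x) has_derivative (\<lambda>v. f x * m v + f' x v * m x)) (at x)" for x
    by (intro has_derivative_mult f' bounded_linear_imp_has_derivative m)
  moreover have "homogeneous m n (real (Suc n) * c * norm (m v)) (\<lambda>x. f x * m v + f' x v * m x)" for v
  proof (cases n)
    case 0
    then show ?thesis using homogeneous.times_const[OF times_var.hyps, of "m v"] f'(2) by simp
  next
    case (Suc k)
    show ?thesis
      using homogeneous.add[OF homogeneous.times_const[OF times_var.hyps, of "m v"]
          homogeneous.times_var[OF f'(3)[OF Suc, of v], folded Suc]]
      by (simp add: algebra_simps)
  qed
  ultimately show ?case by (intro exI[of _ "\<lambda>x v. f x * m v + f' x v * m x"]) auto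
next
  case (times_const n c f a)
  then obtain f' where f': "\<And>x. (f has_derivative f' x) (at x)" "n = 0 \<Longrightarrow> f' = (\<lambda>_ _. 0)"
    "\<And>k v. n = Suc k \<Longrightarrow> homogeneous m k (real n * c * norm (m v)) (\<lambda>x. f' x v)" by metis
  have "((\<lambda>x. f x * a) has_derivative (\<lambda>v. f' x v * a)) (at x)" for x
    by (intro has_derivative_mult_left f')
  moreover have "homogeneous m k (real n * (c * norm a) * norm (m v)) (\<lambda>x. f' x v * a)" if "n = Suc k" for k v
    using homogeneous.times_const[OF f'(3)[OF that, of v], of a] by (simp add: mult.assoc mult.commute mult.left_commute)
  ultimately show ?case using f'(2) by (intro exI[of _ "\<lambda>x v. f' x v * a"]) auto
next
  case (add n c f d g)
  then obtain f' where f': "\<And>x. (f has_derivative f' x) (at x)" "n = 0 \<Longrightarrow> f' = (\<lambda>_ _. 0)"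
    "\<And>k v. n = Suc k \<Longrightarrow> homogeneous m k (real n * c * norm (m v)) (\<lambda>x. f' x v)" by metis
  from add obtain g' where g': "\<And>x. (g has_derivative g' x) (at x)" "n = 0 \<Longrightarrow> g' = (\<lambda>_ _. 0)"
    "\<And>k v. n = Suc k \<Longrightarrow> homogeneous m k (real n * d * norm (m v)) (\<lambda>x. g' x v)" by metis
  have "((\<lambda>x. f x + g x) has_derivative (\<lambda>v. f' x v + g' x v)) (at x)" for x
    by (intro has_derivative_add f' g')
  moreover have "homogeneous m k (real n * (c + d) * norm (m v)) (\<lambda>x. f' x v + g' x v)" if "n = Suc k" for k v
    using homogeneous.add[OF f'(3)[OF that, of v] g'(3)[OF that, of v]] by (simp add: algebra_simps)
  ultimately show ?case using f'(2) g'(2) by (intro exI[of _ "\<lambda>x v. f' x v + g' x v"]) auto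
qed

lemma homogeneous_power: "homogeneous m n \<bar>c\<bar> (\<lambda>x. c *\<^sub>R m x ^ n)"
proof (induction n)
  case 0
  then show ?case using homogeneous.const[of m "c *\<^sub>R 1"] by simp
next
  case (Suc n)
  then show ?case using homogeneous.times_var[OF Suc] by (simp add: power_commutes)
qed

lemma summable_homogeneous:
  assumes F: "\<And>n. homogeneous m n (c n) (F n)" and c: "converges_below K c" and x: "norm (m x) < K"
  shows "summable (\<lambda>n. F n x)"
proof (rule summable_comparison_test)
  show "summable (\<lambda>n. \<bar>c n\<bar> * norm (m x) ^ n)"
    using c x by (simp add: converges_below_def)
  show "\<exists>N. \<forall>n\<ge>N. norm (F n x) \<le> \<bar>c n\<bar> * norm (m x) ^ n"
    using homogeneous_bound[OF F] homogeneous_nonneg[OF F] by simp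
qed

text \<open>Termwise differentiation: on a ball of radius \<open>r < K\<close> the derivative series is dominated by the
  convergent scalar series with terms \<open>(n + 1) c\<^bsub>n+1\<^esub> r\<^sup>n\<close>. The directional derivative is again a
  series of the same kind, so that the lemma can be iterated.\<close>

lemma homogeneous_series_derivative:
  fixes F :: "nat \<Rightarrow> 'e::real_normed_vector \<Rightarrow> 'a::{real_normed_algebra_1,banach}"
  assumes m: "bounded_linear m"
    and F: "\<And>n. homogeneous m n (c n) (F n)"
    and c: "converges_below K c"
  obtains F' where
    "\<And>n x. (F (Suc n) has_derivative F' n x) (at x)"
    "\<And>n v. homogeneous m n (real (Suc n) * c (Suc n) * norm (m v)) (\<lambda>x. F' n x v)"
    "\<And>v. converges_below K (\<lambda>n. real (Suc n) * c (Suc n) * norm (m v))"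
    "\<And>x. norm (m x) < K \<Longrightarrow>
       ((\<lambda>x. \<Sum>n. F n x) has_derivative (\<lambda>v. \<Sum>n. F' n x v)) (at x)"
proof -
  have "\<forall>n. \<exists>f'. (\<forall>x. (F n has_derivative f' x) (at x)) \<and> (n = 0 \<longrightarrow> f' = (\<lambda>_ _. 0)) \<and>
           (\<forall>k v. n = Suc k \<longrightarrow> homogeneous m k (real n * c n * norm (m v)) (\<lambda>x. f' x v))"
    using homogeneous_derivative[OF F m] by blast
  then obtain D where D: "\<And>n x. (F n has_derivative D n x) (at x)" "D 0 = (\<lambda>_ _. 0)"
    "\<And>k v. homogeneous m k (real (Suc k) * c (Suc k) * norm (m v)) (\<lambda>x. D (Suc k) x v)"
    by metis
  have c0: "0 \<le> c n" for n using homogeneous_nonneg[OF F] .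
  have cd: "converges_below K (\<lambda>n. real (Suc n) * c (Suc n))"
    using converges_below_diffs[OF c] c0 by (simp add: diffs_def)
  have c': "converges_below K (\<lambda>n. real (Suc n) * c (Suc n) * norm (m v))" for v
    unfolding converges_below_def
  proof safe
    fix r assume "0 \<le> r" "r < K"
    then have "summable (\<lambda>n. \<bar>real (Suc n) * c (Suc n)\<bar> * r ^ n * norm (m v))"
      using cd by (intro summable_mult2) (simp add: converges_below_def)
    then show "summable (\<lambda>n. \<bar>real (Suc n) * c (Suc n) * norm (m v)\<bar> * r ^ n)"
      by (simp add: abs_mult mult_ac)
  qed
  obtain b where b: "\<And>v. norm (m v) \<le> norm v * b" "b > 0"
    using bounded_linear.pos_bounded[OF m] by blast
  have "((\<lambda>x. \<Sum>n. F n x) has_derivative (\<lambda>v. \<Sum>n. D (Suc n) x v)) (at x)" if x: "norm (m x) < K" for x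
  proof -
    from x obtain r where r: "norm (m x) < r" "r < K" using dense by blast
    have r0: "0 \<le> r" using r(1) norm_ge_zero[of "m x"] by linarith
    let ?S = "{x. norm (m x) < r}"
    have S: "?S = m -` ball 0 r" by auto
    have "convex ?S" unfolding S
      by (intro convex_linear_vimage bounded_linear.linear m convex_ball)
    have "open ?S"
      by (intro open_Collect_less continuous_intros linear_continuous_on m)
    let ?c = "\<lambda>n. real (Suc n) * c (Suc n) * r ^ n"
    have sc: "summable ?c" using cd r r0 c0 by (auto simp: converges_below_def)
    have bnd: "norm (D (Suc n) y h) \<le> ?c n * b * norm h" if "y \<in> ?S" for n y h
    proof -
      have "norm (D (Suc n) y h) \<le> real (Suc n) * c (Suc n) * norm (m h) * norm (m y) ^ n"
        by (rule homogeneous_bound[OF D(3)])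
      also have "\<dots> \<le> real (Suc n) * c (Suc n) * (norm h * b) * r ^ n"
        using that c0 b by (intro mult_mono power_mono mult_nonneg_nonneg) auto
      finally show ?thesis by (simp add: mult_ac)
    qed
    have sumD: "summable (\<lambda>n. D (Suc n) y h)" if "y \<in> ?S" for y h
      by (rule summable_homogeneous[OF D(3) c']) (use that r in auto)
    have tail: "norm (sum (\<lambda>i. D i y h) {..<Suc N} - (\<Sum>n. D (Suc n) y h)) \<le> (\<Sum>n. ?c (n + N)) * b * norm h"
      if y: "y \<in> ?S" for N y h
    proof -
      have s: "sum (\<lambda>i. D i y h) {..<Suc N} = (\<Sum>n<N. D (Suc n) y h)"
        unfolding sum.lessThan_Suc_shift using D(2) by simp
      have "(\<Sum>n. D (Suc n) y h) - sum (\<lambda>i. D i y h) {..<Suc N} = (\<Sum>n. D (Suc (n + N)) y h)"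
        unfolding s using suminf_minus_initial_segment[OF sumD[OF y], of N] by simp
      then have "norm (sum (\<lambda>i. D i y h) {..<Suc N} - (\<Sum>n. D (Suc n) y h)) = norm (\<Sum>n. D (Suc (n + N)) y h)"
        by (metis norm_minus_commute)
      also have "\<dots> \<le> (\<Sum>n. ?c (n + N) * (b * norm h))"
      proof (rule norm_suminf_le)
        show "norm (D (Suc (n + N)) y h) \<le> ?c (n + N) * (b * norm h)" for n
          using bnd[OF y, of "n + N" h] by (simp only: mult.assoc)
        show "summable (\<lambda>n. ?c (n + N) * (b * norm h))"
          by (intro summable_mult2 summable_ignore_initial_segment[OF sc])
      qed
      also have "\<dots> = (\<Sum>n. ?c (n + N)) * (b * norm h)"
        by (intro suminf_mult2[symmetric] summable_ignore_initial_segment[OF sc])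
      finally show ?thesis by (simp only: mult.assoc)
    qed
    have "\<exists>g. \<forall>y\<in>?S. (\<lambda>n. F n y) sums (g y) \<and> (g has_derivative (\<lambda>v. \<Sum>n. D (Suc n) y v)) (at y within ?S)"
    proof (rule has_derivative_series[OF \<open>convex ?S\<close>])
      show "(F n has_derivative D n y) (at y within ?S)" for n y
        using D(1) has_derivative_at_withinI by blast
      show "x \<in> ?S" using r by simp
      show "(\<lambda>n. F n x) sums (\<Sum>n. F n x)"
        by (intro summable_sums summable_homogeneous[OF F c x])
      fix e :: real assume "e > 0"
      have "(\<lambda>N. (\<Sum>n. ?c (n + N)) * b) \<longlonglongrightarrow> 0"
        using tendsto_mult_right[OF suminf_exist_split2[OF sc], of b] by simp
      then have "\<forall>\<^sub>F N in sequentially. (\<Sum>n. ?c (n + N)) * b < e"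
        using \<open>e > 0\<close> by (auto dest: order_tendstoD)
      then have "\<forall>\<^sub>F N in sequentially. \<forall>y\<in>?S. \<forall>h. norm (sum (\<lambda>i. D i y h) {..<Suc N} - (\<Sum>n. D (Suc n) y h)) \<le> e * norm h"
      proof (rule eventually_mono, intro ballI allI)
        fix N y and h :: 'e assume N: "(\<Sum>n. ?c (n + N)) * b < e" and y: "y \<in> ?S"
        have "(\<Sum>n. ?c (n + N)) * b * norm h \<le> e * norm h"
          by (rule mult_right_mono) (use N in auto)
        with tail[OF y, of h N] show "norm (sum (\<lambda>i. D i y h) {..<Suc N} - (\<Sum>n. D (Suc n) y h)) \<le> e * norm h"
          by linarith
      qed
      then show "\<forall>\<^sub>F n in sequentially. \<forall>x\<in>?S. \<forall>h. norm (sum (\<lambda>i. D i x h) {..<n} - (\<Sum>n. D (Suc n) x h)) \<le> e * norm h"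
        by (subst (asm) eventually_sequentially_Suc)
    qed
    then obtain g where g: "\<And>y. y \<in> ?S \<Longrightarrow> (\<lambda>n. F n y) sums (g y)"
      "\<And>y. y \<in> ?S \<Longrightarrow> (g has_derivative (\<lambda>v. \<Sum>n. D (Suc n) y v)) (at y within ?S)" by blast
    have xS: "x \<in> ?S" using r by simp
    have "(g has_derivative (\<lambda>v. \<Sum>n. D (Suc n) x v)) (at x)"
      using g(2)[OF xS] unfolding at_within_open[OF xS \<open>open ?S\<close>] .
    then show ?thesis
      by (rule has_derivative_transform_within_open[OF _ \<open>open ?S\<close> xS]) (use g(1) in \<open>simp add: sums_iff\<close>)
  qed
  with D(1,3) c' show ?thesis by (intro that[of "\<lambda>n. D (Suc n)"])
qed

lemma power_series_commute:
  fixes y :: "'a::{real_normed_algebra_1,banach}"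
  assumes "converges_below K c" "norm y < K" "y * z = z * y"
  shows "power_series c y * z = z * power_series c y"
proof -
  note s = power_series_sums[OF assms(1,2)]
  have "y ^ n * z = z * y ^ n" for n
    using assms(3) by (rule power_commuting_commutes)
  then show ?thesis
    using sums_unique2[OF sums_mult2[OF s, of z]] sums_mult[OF s, of z] by simp
qed

lemma has_derivative_exp_0: "(exp has_derivative (\<lambda>h. h)) (at (0::'a::{real_normed_algebra_1,banach}))"
  unfolding has_derivative_at
proof (safe intro!: bounded_linear_ident)
  have "((\<lambda>h::'a. exp (norm h) - 1) \<longlongrightarrow> exp (norm (0::'a)) - 1) (at 0)"
    by (intro tendsto_intros)
  then have lim: "((\<lambda>h::'a. exp (norm h) - 1) \<longlongrightarrow> 0) (at 0)" by simp
  have bound: "norm (norm (exp (0 + h) - exp 0 - h) / norm h) \<le> exp (norm h) - 1" for h :: 'a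
    using exp_minus_id_lipschitz[of h "norm h" 0] by (cases "h = 0") (auto simp: field_simps)
  show "((\<lambda>h::'a. norm (exp (0 + h) - exp 0 - h) / norm h) \<longlongrightarrow> 0) (at 0)"
    by (rule Lim_null_comparison[OF _ lim]) (rule always_eventually, rule allI, rule bound)
qed

text \<open>Along the segment \<open>t y\<close> everything commutes, and \<open>L(t) = log(1 + t y)\<close> satisfies
  \<open>L'(t) (1 + t y) = y\<close>, because \<open>L'(t)\<close> is the geometric series times \<open>y\<close>. Therefore
  \<open>exp(- L(t)) (1 + t y)\<close> has derivative 0 and keeps its value 1 from \<open>t = 0\<close>.\<close>

lemma exp_log_series:
  fixes y :: "'a::{real_normed_algebra_1,banach}"
  assumes y: "norm y < 1"
  shows "exp (log_series y) = 1 + y"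
proof -
  define g where "g t = log_series (t *\<^sub>R y)" for t
  define c :: "nat \<Rightarrow> real" where "c = (\<lambda>n. (- 1) ^ Suc n / of_nat n)"
  let ?m = "\<lambda>t. t *\<^sub>R y"
  have m: "bounded_linear ?m" by (rule bounded_linear_scaleR_left)
  have c: "converges_below 1 (\<lambda>n. \<bar>c n\<bar>)"
    using converges_below_log by (simp add: c_def converges_below_def)
  have hom: "homogeneous ?m n \<bar>c n\<bar> (\<lambda>t. c n *\<^sub>R ?m t ^ n)" for n
    by (rule homogeneous_power)
  obtain F' where F': "\<And>n x. ((\<lambda>t. c (Suc n) *\<^sub>R ?m t ^ Suc n) has_derivative F' n x) (at x)"
    "\<And>n v. homogeneous ?m n (real (Suc n) * \<bar>c (Suc n)\<bar> * norm (?m v)) (\<lambda>x. F' n x v)"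
    "\<And>v. converges_below 1 (\<lambda>n. real (Suc n) * \<bar>c (Suc n)\<bar> * norm (?m v))"
    "\<And>x. norm (?m x) < 1 \<Longrightarrow>
       ((\<lambda>x. \<Sum>n. c n *\<^sub>R ?m x ^ n) has_derivative (\<lambda>v. \<Sum>n. F' n x v)) (at x)"
    by (rule homogeneous_series_derivative[OF m hom c]) (rule that)
  have F'_eq: "F' n t h = h *\<^sub>R (((- 1) gchoose n) *\<^sub>R ?m t ^ n * y)" for n t h
  proof -
    have "((\<lambda>t. t ^ Suc n *\<^sub>R (c (Suc n) *\<^sub>R y ^ Suc n)) has_derivative
        (\<lambda>h. (h * (real (Suc n) * t ^ n)) *\<^sub>R (c (Suc n) *\<^sub>R y ^ Suc n))) (at t)"
      by (intro derivative_eq_intros refl) auto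
    moreover have "((\<lambda>t. t ^ Suc n *\<^sub>R (c (Suc n) *\<^sub>R y ^ Suc n)) has_derivative F' n t) (at t)"
      using F'(1)[of n t] by (simp add: mult.commute)
    ultimately have "F' n t h = (h * (real (Suc n) * t ^ n)) *\<^sub>R (c (Suc n) *\<^sub>R y ^ Suc n)"
      by (metis has_derivative_unique)
    also have "real (Suc n) * c (Suc n) = (- 1) ^ n" by (simp add: c_def)
    then have "(h * (real (Suc n) * t ^ n)) *\<^sub>R (c (Suc n) *\<^sub>R y ^ Suc n) = (h * ((- 1) ^ n * t ^ n)) *\<^sub>R y ^ Suc n"
      by (metis (no_types, opaque_lifting) mult.assoc mult.commute scaleR_scaleR)
    also have "(-1 :: real) gchoose n = (- 1) ^ n"
      using gbinomial_minus[of "1::real" n] binomial_gbinomial[of n n, where 'a = real] by simp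
    ultimately show ?thesis by (simp add: power_commutes)
  qed
  define g' where "g' t = binomial_series (- 1) (t *\<^sub>R y) * y" for t
  have small: "norm (t *\<^sub>R y) < 1" if "t \<in> {0..1}" for t
    using that y mult_right_mono[of t 1 "norm y"] by auto
  have g: "(g has_derivative (\<lambda>h. h *\<^sub>R g' t)) (at t)" if "t \<in> {0..1}" for t
  proof -
    have s: "(\<lambda>n. ((- 1) gchoose n) *\<^sub>R ?m t ^ n) sums binomial_series (- 1) (t *\<^sub>R y)"
      unfolding binomial_series_def
      by (rule power_series_sums[OF converges_below_gbinomial small[OF that]])
    have "(\<lambda>n. F' n t h) sums (h *\<^sub>R g' t)" for h
      unfolding F'_eq g'_def by (intro sums_scaleR_right sums_mult2 s)
    then have "(\<Sum>n. F' n t h) = h *\<^sub>R g' t" for h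
      by (simp add: sums_iff)
    with F'(4)[OF small[OF that]] show ?thesis
      unfolding g_def log_series_def power_series_def c_def by simp
  qed
  have comm: "y * g t = g t * y" if "t \<in> {0..1}" for t
    unfolding g_def log_series_def
    using power_series_commute[OF converges_below_log small[OF that], of y] by simp
  have comm': "g s * g t = g t * g s" if "s \<in> {0..1}" "t \<in> {0..1}" for s t
    using power_series_commute[OF converges_below_log small[OF that(1)], of "g t"] comm[OF that(2)]
    unfolding g_def log_series_def by simp
  let ?h = "\<lambda>t. exp (- g t) * (1 + t *\<^sub>R y)"
  have "(?h has_derivative (\<lambda>_. 0)) (at t within {0..1})" if t: "t \<in> {0..1}" for t
  proof -
    have gt: "(g has_derivative (\<lambda>h. h *\<^sub>R g' t)) (at t within {0..1})"
      using g[OF t] by (rule has_derivative_at_withinI)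
    (* Since the values of g commute, exp (- g s) is exp (- g t) times exp (g t - g s), and the
       derivative of exp is only needed at 0. *)
    have "((\<lambda>s. exp (g t - g s)) has_derivative (\<lambda>h. - (h *\<^sub>R g' t))) (at t within {0..1})"
      using has_derivative_compose[of "\<lambda>s. g t - g s" "\<lambda>h. - (h *\<^sub>R g' t)" t "{0..1}" exp "\<lambda>h. h"]
        has_derivative_diff[OF has_derivative_const gt, of "g t"] has_derivative_exp_0 by simp
    then have "((\<lambda>s. exp (- g t) * exp (g t - g s) * (1 + s *\<^sub>R y)) has_derivative
       (\<lambda>h. exp (- g t) * exp (g t - g t) * (h *\<^sub>R y) + exp (- g t) * (- (h *\<^sub>R g' t)) * (1 + t *\<^sub>R y))) (at t within {0..1})"
      by (auto intro!: derivative_eq_intros)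
    moreover have "g' t * (1 + t *\<^sub>R y) = y"
    proof -
      have "g' t * (1 + t *\<^sub>R y) = binomial_series (- 1) (t *\<^sub>R y) * binomial_series 1 (t *\<^sub>R y) * y"
        unfolding g'_def by (simp add: algebra_simps)
      also have "\<dots> = y" by (subst binomial_series_mult[OF small[OF t]]) simp
      finally show ?thesis .
    qed
    then have "exp (- g t) * exp (g t - g t) * (h *\<^sub>R y) + exp (- g t) * (- (h *\<^sub>R g' t)) * (1 + t *\<^sub>R y) = 0" for h
      by (simp add: mult.assoc)
    ultimately have "((\<lambda>s. exp (- g t) * exp (g t - g s) * (1 + s *\<^sub>R y)) has_derivative (\<lambda>_. 0)) (at t within {0..1})"
      by (simp only:)
    moreover have "exp (- g t) * exp (g t - g s) = exp (- g s)" if "s \<in> {0..1}" for s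
      by (subst exp_add_commuting[symmetric]) (use comm'[OF that t] in \<open>auto simp: algebra_simps\<close>)
    ultimately show ?thesis
      by (elim has_derivative_transform[OF t, rotated]) simp
  qed
  then have "?h 1 = ?h 0"
    by (intro has_derivative_zero_unique[of "{0..1}" ?h 1 0]) auto
  then have "exp (- log_series y) * (1 + y) = 1"
    by (simp add: g_def)
  then have "exp (log_series y) * (exp (- log_series y) * (1 + y)) = exp (log_series y)" by simp
  then show ?thesis by (simp add: mult.assoc[symmetric] exp_minus_inverse)
qed

section \<open>The Banach algebra of endomorphisms\<close>

text \<open>A copy of the bounded operators on \<open>\<real>\<^sup>p\<close> that carries composition as its multiplication.\<close>

typedef 'p::finite endo = "UNIV :: ((real^'p) \<Rightarrow>\<^sub>L (real^'p)) set"
  morphisms endo_map Endo by simp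

setup_lifting type_definition_endo

instantiation endo :: (finite) real_normed_algebra_1
begin

lift_definition zero_endo :: "'a endo" is 0 .
lift_definition one_endo :: "'a endo" is id_blinfun .
lift_definition plus_endo :: "'a endo \<Rightarrow> 'a endo \<Rightarrow> 'a endo" is "(+)" .
lift_definition minus_endo :: "'a endo \<Rightarrow> 'a endo \<Rightarrow> 'a endo" is "(-)" .
lift_definition uminus_endo :: "'a endo \<Rightarrow> 'a endo" is uminus .
lift_definition times_endo :: "'a endo \<Rightarrow> 'a endo \<Rightarrow> 'a endo" is blinfun_compose .
lift_definition scaleR_endo :: "real \<Rightarrow> 'a endo \<Rightarrow> 'a endo" is scaleR .
lift_definition norm_endo :: "'a endo \<Rightarrow> real" is norm .

definition dist_endo :: "'a endo \<Rightarrow> 'a endo \<Rightarrow> real" where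
  "dist_endo a b = norm (a - b)"
definition sgn_endo :: "'a endo \<Rightarrow> 'a endo" where
  "sgn_endo a = inverse (norm a) *\<^sub>R a"
definition uniformity_endo :: "('a endo \<times> 'a endo) filter" where
  "uniformity_endo = (INF e\<in>{0 <..}. principal {(x, y). dist x y < e})"
definition open_endo :: "'a endo set \<Rightarrow> bool" where
  "open_endo U = (\<forall>x\<in>U. eventually (\<lambda>(x', y). x' = x \<longrightarrow> y \<in> U) uniformity)"

instance
proof
  fix a b c :: "'a endo" and r s :: real and U :: "'a endo set"
  show "a + b + c = a + (b + c)" by transfer simp
  show "a + b = b + a" by transfer simp
  show "0 + a = a" by transfer simp
  show "- a + a = 0" by transfer simp
  show "a - b = a + - b" by transfer simp
  show "r *\<^sub>R (a + b) = r *\<^sub>R a + r *\<^sub>R b" by transfer (rule scaleR_add_right)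
  show "(r + s) *\<^sub>R a = r *\<^sub>R a + s *\<^sub>R a" by transfer (rule scaleR_add_left)
  show "r *\<^sub>R s *\<^sub>R a = (r * s) *\<^sub>R a" by transfer simp
  show "1 *\<^sub>R a = a" by transfer simp
  show "a * b * c = a * (b * c)" by transfer (simp add: blinfun_eqI)
  show "1 * a = a" by transfer (simp add: blinfun_eqI)
  show "a * 1 = a" by transfer (simp add: blinfun_eqI)
  show "(a + b) * c = a * c + b * c" by transfer (simp add: blinfun_eqI blinfun.bilinear_simps)
  show "a * (b + c) = a * b + a * c" by transfer (simp add: blinfun_eqI blinfun.bilinear_simps)
  show "r *\<^sub>R a * b = r *\<^sub>R (a * b)" by transfer (simp add: blinfun_eqI blinfun.bilinear_simps)
  show "a * r *\<^sub>R b = r *\<^sub>R (a * b)" by transfer (simp add: blinfun_eqI blinfun.bilinear_simps)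
  show "dist a b = norm (a - b)" by (rule dist_endo_def)
  show "sgn a = inverse (norm a) *\<^sub>R a" by (rule sgn_endo_def)
  show "uniformity = (INF e\<in>{0 <..}. principal {(x, y :: 'a endo). dist x y < e})"
    by (rule uniformity_endo_def)
  show "open U = (\<forall>x\<in>U. eventually (\<lambda>(x', y). x' = x \<longrightarrow> y \<in> U) uniformity)"
    by (rule open_endo_def)
  show "(norm a = 0) = (a = 0)" by transfer simp
  show "norm (a + b) \<le> norm a + norm b" by transfer (rule norm_triangle_ineq)
  show "norm (r *\<^sub>R a) = \<bar>r\<bar> * norm a" by transfer simp
  show "norm (a * b) \<le> norm a * norm b" by transfer (rule norm_blinfun_compose)
  show "norm (1 :: 'a endo) = 1" by transfer simp
  have "norm (0 :: 'a endo) = 0" "norm (1 :: 'a endo) = 1" by (transfer, simp)+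
  then have "norm (0 :: 'a endo) \<noteq> norm (1 :: 'a endo)" by (simp only:)
  then show "(0::'a endo) \<noteq> 1" by (rule contrapos_nn) (rule arg_cong)
qed

end

lemma norm_endo_map [simp]: "norm (endo_map a) = norm a"
  by (simp add: norm_endo.rep_eq)

instance endo :: (finite) banach
proof
  fix X :: "nat \<Rightarrow> 'a endo" assume X: "Cauchy X"
  have d: "dist (endo_map a) (endo_map b) = dist a b" for a b :: "'a endo"
    by (simp add: dist_norm minus_endo.rep_eq[symmetric])
  have "Cauchy (\<lambda>n. endo_map (X n))"
    using X by (simp add: Cauchy_def d)
  then obtain L where "(\<lambda>n. endo_map (X n)) \<longlonglongrightarrow> L"
    using Cauchy_convergent_iff convergent_def by blast
  then have "X \<longlonglongrightarrow> Endo L"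
    by (simp add: tendsto_iff d[symmetric] Endo_inverse)
  then show "convergent X" by (rule convergentI)
qed

definition endo_of_matrix :: "real^'p^'p \<Rightarrow> 'p::finite endo" where
  "endo_of_matrix A = Endo (Blinfun ((*v) A))"

definition matrix_of_endo :: "'p::finite endo \<Rightarrow> real^'p^'p" where
  "matrix_of_endo a = matrix (endo_map a)"

lemma endo_map_of_matrix [simp]: "blinfun_apply (endo_map (endo_of_matrix A)) x = A *v x"
  by (simp add: endo_of_matrix_def Endo_inverse bounded_linear_Blinfun_apply matrix_vector_mul_bounded_linear)

lemma matrix_of_endo_of_matrix [simp]: "matrix_of_endo (endo_of_matrix A) = A"
  unfolding matrix_of_endo_def endo_map_of_matrix[abs_def] by (rule matrix_of_matrix_vector_mul)

lemma endo_eqI: "(\<And>x. endo_map a x = endo_map b x) \<Longrightarrow> a = b"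
  by (simp add: endo_map_inject[symmetric] blinfun_eqI)

lemma endo_of_matrix_of_endo [simp]: "endo_of_matrix (matrix_of_endo a) = a"
  by (rule endo_eqI) (simp add: matrix_of_endo_def matrix_works bounded_linear.linear[OF blinfun.bounded_linear_right])

lemma endo_of_matrix_inject [simp]: "endo_of_matrix A = endo_of_matrix B \<longleftrightarrow> A = B"
  by (metis matrix_of_endo_of_matrix)

lemma matrix_of_endo_inject [simp]: "matrix_of_endo a = matrix_of_endo b \<longleftrightarrow> a = b"
  by (metis endo_of_matrix_of_endo)

lemma endo_of_matrix_mult: "endo_of_matrix (A ** B) = endo_of_matrix A * endo_of_matrix B"
  by (rule endo_eqI) (simp add: times_endo.rep_eq matrix_vector_mul_assoc)

lemma endo_of_matrix_1 [simp]: "endo_of_matrix (mat 1) = 1"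
  by (rule endo_eqI) (simp add: one_endo.rep_eq)

lemma linear_endo_of_matrix: "linear endo_of_matrix"
  by (intro linearI endo_eqI)
     (simp_all add: plus_endo.rep_eq scaleR_endo.rep_eq blinfun.bilinear_simps matrix_vector_mult_add_rdistrib scaleR_matrix_vector_assoc)

lemma bounded_linear_endo_of_matrix: "bounded_linear endo_of_matrix"
  using linear_endo_of_matrix by (rule linear_conv_bounded_linear[THEN iffD1])

lemmas endo_of_matrix_simps =
  endo_of_matrix_mult linear_add[OF linear_endo_of_matrix] linear_diff[OF linear_endo_of_matrix]
  linear_neg[OF linear_endo_of_matrix] linear_0[OF linear_endo_of_matrix] linear_scale[OF linear_endo_of_matrix]

lemma norm_matrix_vector_le: "norm (A *v x) \<le> norm (endo_of_matrix A) * norm x"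
  using norm_blinfun[of "endo_map (endo_of_matrix A)" x] by simp

lemma norm_endo_of_matrix_bound:
  "0 \<le> b \<Longrightarrow> (\<And>x. norm (A *v x) \<le> b * norm x) \<Longrightarrow> norm (endo_of_matrix A) \<le> b"
  unfolding norm_endo_map[symmetric] by (rule norm_blinfun_bound) auto

lemma linear_matrix_of_endo: "linear matrix_of_endo"
  by (intro linearI) (auto simp: endo_of_matrix_inject[symmetric] endo_of_matrix_simps simp del: endo_of_matrix_inject)

lemma bounded_linear_matrix_of_endo: "bounded_linear (matrix_of_endo :: 'p::finite endo \<Rightarrow> _)"
proof (rule bounded_linear_intro)
  fix a :: "'p endo"
  have "\<bar>matrix_of_endo a $ i $ j\<bar> \<le> norm a" for i j
  proof -
    have "\<bar>matrix_of_endo a $ i $ j\<bar> = \<bar>endo_map a (axis j 1) $ i\<bar>"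
      by (simp add: matrix_of_endo_def matrix_def)
    also have "\<dots> \<le> norm (endo_map a (axis j 1))" by (rule component_le_norm_cart)
    also have "\<dots> \<le> norm a" using norm_blinfun[of "endo_map a" "axis j 1"] by simp
    finally show ?thesis .
  qed
  then have "norm (matrix_of_endo a $ i) \<le> real CARD('p) * norm a" for i
    using order_trans[OF norm_le_l1_cart sum_bounded_above[where A = UNIV]] by fastforce
  then have "norm (matrix_of_endo a) \<le> real CARD('p) * (real CARD('p) * norm a)"
    unfolding norm_vec_def[of "matrix_of_endo a"]
    by (intro order_trans[OF L2_set_le_sum] order_trans[OF sum_bounded_above]) auto
  then show "norm (matrix_of_endo a) \<le> norm a * (real CARD('p) * real CARD('p))"
    by (simp add: mult_ac)
qed (simp_all add: linear_add[OF linear_matrix_of_endo] linear_scale[OF linear_matrix_of_endo])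

lemma matrix_of_endo_mult: "matrix_of_endo (a * b) = matrix_of_endo a ** matrix_of_endo b"
  by (simp add: endo_of_matrix_inject[symmetric] endo_of_matrix_simps del: endo_of_matrix_inject)

lemma matrix_of_endo_1 [simp]: "matrix_of_endo 1 = mat 1"
  by (simp add: endo_of_matrix_inject[symmetric] del: endo_of_matrix_inject)

text \<open>With \<open>y = A\<^sup>T x\<close> one has \<open>\<parallel>y\<parallel>\<^sup>2 = x \<bullet> A y \<le> \<parallel>x\<parallel> \<parallel>A\<parallel> \<parallel>y\<parallel>\<close>.\<close>

lemma norm_endo_of_transpose_le: "norm (endo_of_matrix (transpose A)) \<le> norm (endo_of_matrix A)"
proof (rule norm_endo_of_matrix_bound)
  fix x
  let ?y = "transpose A *v x"
  have "norm ?y * norm ?y = x \<bullet> (A *v ?y)"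
    by (simp add: dot_lmul_matrix[symmetric] power2_norm_eq_inner[symmetric] power2_eq_square[symmetric] transpose_matrix_vector vector_transpose_matrix)
  also have "\<dots> \<le> norm x * norm (A *v ?y)" by (rule norm_cauchy_schwarz)
  also have "\<dots> \<le> norm x * (norm (endo_of_matrix A) * norm ?y)"
    by (intro mult_left_mono norm_matrix_vector_le) auto
  finally have "norm ?y * norm ?y \<le> (norm (endo_of_matrix A) * norm x) * norm ?y" by (simp add: mult_ac)
  then show "norm ?y \<le> norm (endo_of_matrix A) * norm x"
    by (cases "norm ?y = 0") (auto simp: mult_le_cancel_right)
qed simp

lemma norm_endo_of_transpose [simp]: "norm (endo_of_matrix (transpose A)) = norm (endo_of_matrix A)"
  using norm_endo_of_transpose_le[of A] norm_endo_of_transpose_le[of "transpose A"] by simp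

section \<open>Calculus of continuously differentiable maps\<close>

lemma Ck_on_cong:
  assumes "open S" "Ck_on k S f" "\<And>x. x \<in> S \<Longrightarrow> f x = g x"
  shows "Ck_on k S g"
  using assms(2,3)
proof (induction k arbitrary: f g)
  case 0
  then show ?case by (simp cong: continuous_on_cong)
next
  case (Suc k)
  have g: "(g has_derivative frechet_derivative f (at x)) (at x)" if "x \<in> S" for x
  proof (rule has_derivative_transform_within_open[OF _ \<open>open S\<close> that])
    show "(f has_derivative frechet_derivative f (at x)) (at x)"
      using Suc.prems(1) that by (simp add: frechet_derivative_works[symmetric])
  qed (use Suc.prems in auto)
  then have eq: "frechet_derivative g (at x) = frechet_derivative f (at x)" if "x \<in> S" for x
    using frechet_derivative_at[OF g[OF that]] by simp
  have "Ck_on k S (\<lambda>x. frechet_derivative g (at x) v)" for v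
    by (rule Suc.IH[of "\<lambda>x. frechet_derivative f (at x) v", rotated]) (use Suc.prems(1) in \<open>simp_all add: eq\<close>)
  with g show ?case by (auto simp: differentiable_def)
qed

lemma Ck_on_SucI:
  assumes "open S" "\<And>x. x \<in> S \<Longrightarrow> (f has_derivative D x) (at x)"
    and "\<And>v. Ck_on k S (\<lambda>x. D x v)"
  shows "Ck_on (Suc k) S f"
proof -
  have "frechet_derivative f (at x) = D x" if "x \<in> S" for x
    using frechet_derivative_at[OF assms(2)[OF that]] by simp
  then have "Ck_on k S (\<lambda>x. frechet_derivative f (at x) v)" for v
    by (intro Ck_on_cong[OF assms(1) assms(3)[of v]]) simp
  with assms(2) show ?thesis by (auto simp: differentiable_def)
qed

lemma Ck_on_SucD: "Ck_on (Suc k) S f \<Longrightarrow> Ck_on k S f"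
proof (induction k arbitrary: f)
  case 0
  then show ?case
    by (auto intro!: differentiable_imp_continuous_on differentiable_at_imp_differentiable_on)
next
  case (Suc k)
  from Suc.prems have "\<forall>x\<in>S. f differentiable (at x)" by simp
  moreover have "Ck_on k S (\<lambda>x. frechet_derivative f (at x) v)" for v
    using Suc.prems unfolding Ck_on.simps(2)[of "Suc k"] by (intro Suc.IH) blast
  ultimately show ?case by simp
qed

lemma Ck_on_has_derivative:
  "Ck_on (Suc k) S f \<Longrightarrow> x \<in> S \<Longrightarrow> (f has_derivative frechet_derivative f (at x)) (at x)"
  by (simp add: frechet_derivative_works[symmetric])

lemma Ck_on_continuous_on: "Ck_on k S f \<Longrightarrow> continuous_on S f"
  by (induction k) (use Ck_on_SucD in \<open>auto simp del: Ck_on.simps(2)\<close>)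

lemma Ck_on_subset: "Ck_on k S f \<Longrightarrow> T \<subseteq> S \<Longrightarrow> Ck_on k T f"
  by (induction k arbitrary: f) (auto intro: continuous_on_subset)

lemma Ck_on_const: "open S \<Longrightarrow> Ck_on k S (\<lambda>_. c)"
  by (induction k arbitrary: c) (auto intro!: Ck_on_SucI[where D = "\<lambda>_ _. 0"] simp del: Ck_on.simps(2))

lemma Ck_on_bounded_linear:
  assumes "bounded_linear f" "open S"
  shows "Ck_on k S f"
proof (cases k)
  case 0
  then show ?thesis by (simp add: linear_continuous_on assms)
next
  case (Suc j)
  show ?thesis unfolding Suc
    by (rule Ck_on_SucI[where D = "\<lambda>_. f"])
       (auto intro: assms bounded_linear_imp_has_derivative Ck_on_const)
qed

lemma Ck_on_compose_bounded_linear: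
  assumes "bounded_linear T" "open S" "Ck_on k S f"
  shows "Ck_on k S (\<lambda>x. T (f x))"
  using assms(3)
proof (induction k arbitrary: f)
  case 0
  then show ?case by (auto intro: bounded_linear.continuous_on assms(1))
next
  case (Suc k)
  show ?case
  proof (rule Ck_on_SucI[OF \<open>open S\<close>])
    show "((\<lambda>x. T (f x)) has_derivative (\<lambda>v. T (frechet_derivative f (at x) v))) (at x)" if "x \<in> S" for x
      by (rule bounded_linear.has_derivative[OF assms(1) Ck_on_has_derivative[OF Suc.prems that]])
  qed (use Suc in auto)
qed

lemma Ck_on_add:
  assumes "open S" "Ck_on k S f" "Ck_on k S g"
  shows "Ck_on k S (\<lambda>x. f x + g x)"
  using assms(2,3)
proof (induction k arbitrary: f g)
  case 0
  then show ?case by (auto intro: continuous_on_add)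
next
  case (Suc k)
  show ?case
  proof (rule Ck_on_SucI[OF \<open>open S\<close>])
    show "((\<lambda>x. f x + g x) has_derivative
        (\<lambda>v. frechet_derivative f (at x) v + frechet_derivative g (at x) v)) (at x)" if "x \<in> S" for x
      by (intro has_derivative_add Ck_on_has_derivative[OF Suc.prems(1) that] Ck_on_has_derivative[OF Suc.prems(2) that])
  qed (use Suc in auto)
qed

lemma Ck_on_sum:
  assumes "open S" "finite I" "\<And>i. i \<in> I \<Longrightarrow> Ck_on k S (f i)"
  shows "Ck_on k S (\<lambda>x. \<Sum>i\<in>I. f i x)"
  using assms(2,3) by (induction I rule: finite_induct) (auto intro: Ck_on_add Ck_on_const assms(1))

lemma Ck_on_bounded_bilinear:
  assumes "bounded_bilinear p" "open S" "Ck_on k S f" "Ck_on k S g"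
  shows "Ck_on k S (\<lambda>x. p (f x) (g x))"
  using assms(3,4)
proof (induction k arbitrary: f g)
  case 0
  then show ?case by (auto intro: bounded_bilinear.continuous_on[OF assms(1)])
next
  case (Suc k)
  show ?case
  proof (rule Ck_on_SucI[OF \<open>open S\<close>])
    show "((\<lambda>x. p (f x) (g x)) has_derivative
        (\<lambda>v. p (f x) (frechet_derivative g (at x) v) + p (frechet_derivative f (at x) v) (g x))) (at x)"
      if "x \<in> S" for x
      by (intro bounded_bilinear.FDERIV[OF assms(1)] Ck_on_has_derivative[OF Suc.prems(1) that] Ck_on_has_derivative[OF Suc.prems(2) that])
    show "Ck_on k S (\<lambda>x. p (f x) (frechet_derivative g (at x) v) + p (frechet_derivative f (at x) v) (g x))" for v
      using Suc.prems by (intro Ck_on_add \<open>open S\<close> Suc.IH Ck_on_SucD[OF Suc.prems(1)] Ck_on_SucD[OF Suc.prems(2)]) auto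
  qed
qed

text \<open>The chain rule alone does not express the derivative of a composition through functions of class
  \<open>C\<^sup>k\<close>, since its direction depends on the point. Expanding the direction in a basis turns it into
  a finite sum of products to which the induction hypothesis applies.\<close>

lemma Ck_on_compose:
  fixes f :: "'a::euclidean_space \<Rightarrow> 'b::euclidean_space" and g :: "'b \<Rightarrow> 'c::euclidean_space"
  assumes "open S" "Ck_on k S f" "Ck_on k T g" "f ` S \<subseteq> T"
  shows "Ck_on k S (\<lambda>x. g (f x))"
  using assms(2,3)
proof (induction k arbitrary: g)
  case 0
  then show ?case using continuous_on_compose2[of T g S f] assms(4) by simp
next
  case (Suc k)
  let ?D = "\<lambda>x v. \<Sum>b\<in>Basis. (frechet_derivative f (at x) v \<bullet> b) *\<^sub>R frechet_derivative g (at (f x)) b"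
  show ?case
  proof (rule Ck_on_SucI[OF \<open>open S\<close>])
    fix x assume "x \<in> S"
    then have g: "(g has_derivative frechet_derivative g (at (f x))) (at (f x))"
      using assms(4) by (intro Ck_on_has_derivative[OF Suc.prems(2)]) auto
    define L where "L = frechet_derivative g (at (f x))"
    have lin: "linear L" unfolding L_def by (rule has_derivative_linear[OF g])
    have L: "L w = (\<Sum>b\<in>Basis. (w \<bullet> b) *\<^sub>R L b)" for w
    proof -
      have "L w = L (\<Sum>b\<in>Basis. (w \<bullet> b) *\<^sub>R b)" by (simp only: euclidean_representation)
      also have "\<dots> = (\<Sum>b\<in>Basis. (w \<bullet> b) *\<^sub>R L b)"
        by (simp only: linear_sum[OF lin] linear_scale[OF lin])
      finally show ?thesis .
    qed
    have "((\<lambda>x. g (f x)) has_derivative (\<lambda>v. L (frechet_derivative f (at x) v))) (at x)"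
      unfolding L_def
      by (rule has_derivative_compose[OF Ck_on_has_derivative[OF Suc.prems(1) \<open>x \<in> S\<close>] g])
    then show "((\<lambda>x. g (f x)) has_derivative ?D x) (at x)"
      by (subst (asm) L) (simp only: L_def)
  next
    fix v
    show "Ck_on k S (\<lambda>x. ?D x v)"
    proof (intro Ck_on_sum \<open>open S\<close> finite_Basis Ck_on_bounded_bilinear[OF bounded_bilinear_scaleR])
      fix b :: 'b
      show "Ck_on k S (\<lambda>x. frechet_derivative f (at x) v \<bullet> b)"
        using Suc.prems(1) by (intro Ck_on_compose_bounded_linear[OF bounded_linear_inner_left \<open>open S\<close>]) auto
      show "Ck_on k S (\<lambda>x. frechet_derivative g (at (f x)) b)"
        using Suc.prems Suc.IH[OF Ck_on_SucD[OF Suc.prems(1)], of "\<lambda>y. frechet_derivative g (at y) b"] by simp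
    qed
  qed
qed

text \<open>The directional derivative of such a series is a series of the same kind with the same radius.
  The induction therefore runs over all these series simultaneously.\<close>

lemma Ck_on_homogeneous_series:
  fixes F :: "nat \<Rightarrow> 'e::euclidean_space \<Rightarrow> 'a::{real_normed_algebra_1,banach}"
    and T :: "'a \<Rightarrow> 'b::euclidean_space"
  assumes m: "bounded_linear m" and T: "bounded_linear T"
    and F: "\<And>n. homogeneous m n (c n) (F n)"
    and c: "converges_below K c"
  shows "Ck_on k {x. norm (m x) < K} (\<lambda>x. T (\<Sum>n. F n x))"
  using F c
proof (induction k arbitrary: F c)
  case 0
  have "\<exists>D. \<forall>x. norm (m x) < K \<longrightarrow> ((\<lambda>x. \<Sum>n. F n x) has_derivative D x) (at x)"
    by (rule homogeneous_series_derivative[OF m 0]) (rule exI, rule allI, rule impI)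
  then have "continuous_on {x. norm (m x) < K} (\<lambda>x. \<Sum>n. F n x)"
    by (intro continuous_at_imp_continuous_on) (auto intro: has_derivative_continuous)
  then show ?case by (simp add: bounded_linear.continuous_on[OF T])
next
  case (Suc k)
  obtain F' where F':
    "\<And>n x. (F (Suc n) has_derivative F' n x) (at x)"
    "\<And>n v. homogeneous m n (real (Suc n) * c (Suc n) * norm (m v)) (\<lambda>x. F' n x v)"
    "\<And>v. converges_below K (\<lambda>n. real (Suc n) * c (Suc n) * norm (m v))"
    "\<And>x. norm (m x) < K \<Longrightarrow> ((\<lambda>x. \<Sum>n. F n x) has_derivative (\<lambda>v. \<Sum>n. F' n x v)) (at x)"
    by (rule homogeneous_series_derivative[OF m Suc.prems]) (rule that)
  show ?case
  proof (rule Ck_on_SucI)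
    show "open {x. norm (m x) < K}"
      by (intro open_Collect_less continuous_intros linear_continuous_on m)
    show "((\<lambda>x. T (\<Sum>n. F n x)) has_derivative (\<lambda>v. T (\<Sum>n. F' n x v))) (at x)"
      if "x \<in> {x. norm (m x) < K}" for x
      using that by (intro bounded_linear.has_derivative[OF T] F') simp
    show "Ck_on k {x. norm (m x) < K} (\<lambda>x. T (\<Sum>n. F' n x v))" for v
      by (rule Suc.IH[OF F'(2,3)])
  qed
qed

lemma Ck_on_power_series:
  fixes m :: "'e::euclidean_space \<Rightarrow> 'a::{real_normed_algebra_1,banach}"
    and T :: "'a \<Rightarrow> 'b::euclidean_space"
  assumes "bounded_linear m" "bounded_linear T" "converges_below K c"
  shows "Ck_on k {x. norm (m x) < K} (\<lambda>x. T (power_series c (m x)))"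
proof -
  have "converges_below K (\<lambda>n. \<bar>c n\<bar>)"
    using assms(3) by (simp add: converges_below_def)
  then show ?thesis
    unfolding power_series_def
    by (rule Ck_on_homogeneous_series[OF assms(1,2) homogeneous_power])
qed

section \<open>Matrix functions given by power series\<close>

lemma bounded_bilinear_matrix_mult:
  "bounded_bilinear ((**) :: real^'b^'a \<Rightarrow> real^'c^'b \<Rightarrow> real^'c^'a)"
  unfolding bilinear_conv_bounded_bilinear[symmetric] bilinear_def
  by (auto intro!: linearI simp: matrix_add_ldistrib matrix_matrix_mult_def vec_eq_iff sum.distrib algebra_simps sum_distrib_left)

lemmas matrix_mult_add =
  bounded_bilinear.add_left[OF bounded_bilinear_matrix_mult]
  bounded_bilinear.add_right[OF bounded_bilinear_matrix_mult]

lemmas matrix_mult_diff =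
  bounded_bilinear.diff_left[OF bounded_bilinear_matrix_mult]
  bounded_bilinear.diff_right[OF bounded_bilinear_matrix_mult]

lemma linear_transpose: "linear (transpose :: real^'a^'b \<Rightarrow> real^'b^'a)"
  by (intro linearI) (simp_all add: transpose_def vec_eq_iff)

definition operator_norm :: "real^'p^'p \<Rightarrow> real" where
  "operator_norm A = norm (endo_of_matrix A)"

definition mat_binomial :: "real \<Rightarrow> real^'p^'p \<Rightarrow> real^'p^'p" where
  "mat_binomial a Y = matrix_of_endo (binomial_series a (endo_of_matrix Y))"

definition mat_log_series :: "real^'p^'p \<Rightarrow> real^'p^'p" where
  "mat_log_series Y = matrix_of_endo (log_series (endo_of_matrix Y))"

lemma mat_exp_eq: "mat_exp A = matrix_of_endo (exp (endo_of_matrix A))"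
proof -
  have "mat_power A k = matrix_of_endo (endo_of_matrix A ^ k)" for k
    by (induction k) (simp_all add: mat_power_def matrix_of_endo_mult)
  then have "(1 / fact k) *\<^sub>R mat_power A k = matrix_of_endo (endo_of_matrix A ^ k /\<^sub>R fact k)" for k
    by (simp add: linear_scale[OF linear_matrix_of_endo] inverse_eq_divide)
  then show ?thesis
    unfolding mat_exp_def exp_def
    by (simp add: bounded_linear.suminf[OF bounded_linear_matrix_of_endo summable_exp_generic])
qed

text \<open>Transposition is continuous and linear and reverses products, so it sends \<open>Y\<^sup>n\<close> to
  \<open>(Y\<^sup>T)\<^sup>n\<close>.\<close>

lemma transpose_power_series:
  fixes Y :: "real^'p^'p"
  assumes "converges_below K c" "operator_norm Y < K"
  shows "transpose (matrix_of_endo (power_series c (endo_of_matrix Y))) =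
         matrix_of_endo (power_series c (endo_of_matrix (transpose Y)))"
proof -
  let ?T = "\<lambda>a :: 'p endo. transpose (matrix_of_endo a)"
  have lin: "bounded_linear (\<lambda>A :: real^'p^'p. transpose A)"
    unfolding linear_conv_bounded_linear[symmetric] by (rule linear_transpose)
  have T: "bounded_linear ?T"
    by (rule bounded_linear_compose[OF lin bounded_linear_matrix_of_endo])
  have pow: "?T (endo_of_matrix Y ^ n) = matrix_of_endo (endo_of_matrix (transpose Y) ^ n)" for n
  proof (induction n)
    case (Suc n)
    show ?case
      unfolding power_Suc[of "endo_of_matrix Y"] power_Suc2[of "endo_of_matrix (transpose Y)"]
      by (simp add: matrix_of_endo_mult matrix_transpose_mul Suc)
  qed (simp add: transpose_mat)
  have "(\<lambda>n. c n *\<^sub>R endo_of_matrix Y ^ n) sums power_series c (endo_of_matrix Y)"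
    using assms by (intro power_series_sums) (auto simp: operator_norm_def)
  from bounded_linear.sums[OF T this]
  have "(\<lambda>n. matrix_of_endo (c n *\<^sub>R endo_of_matrix (transpose Y) ^ n)) sums
      ?T (power_series c (endo_of_matrix Y))"
    by (simp only: linear_scale[OF bounded_linear.linear[OF lin]] linear_scale[OF linear_matrix_of_endo] pow)
  moreover have "(\<lambda>n. c n *\<^sub>R endo_of_matrix (transpose Y) ^ n) sums power_series c (endo_of_matrix (transpose Y))"
    using assms by (intro power_series_sums) (auto simp: operator_norm_def)
  note bounded_linear.sums[OF bounded_linear_matrix_of_endo this]
  ultimately show ?thesis by (rule sums_unique2)
qed

lemma exp_power_series: "exp a = power_series (\<lambda>n. inverse (fact n)) a"
  by (simp add: exp_def power_series_def)

lemma transpose_mat_exp: "transpose (mat_exp A) = mat_exp (transpose A)"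
  unfolding mat_exp_eq exp_power_series
  by (rule transpose_power_series[OF converges_below_exp less_add_one])

lemma transpose_mat_binomial:
  "operator_norm Y < 1 \<Longrightarrow> transpose (mat_binomial a Y) = mat_binomial a (transpose Y)"
  unfolding mat_binomial_def binomial_series_def
  by (rule transpose_power_series[OF converges_below_gbinomial])

lemma operator_norm_transpose [simp]: "operator_norm (transpose A) = operator_norm A"
  by (simp add: operator_norm_def)

lemma operator_norm_minus [simp]: "operator_norm (- A) = operator_norm A"
  by (simp add: operator_norm_def endo_of_matrix_simps)

lemma mat_binomial_mult:
  "operator_norm Y < 1 \<Longrightarrow> mat_binomial a Y ** mat_binomial b Y = mat_binomial (a + b) Y"
  by (simp add: mat_binomial_def matrix_of_endo_mult[symmetric] binomial_series_mult operator_norm_def)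

lemma mat_binomial_exponent_0 [simp]: "mat_binomial 0 Y = mat 1"
  by (simp add: mat_binomial_def)

lemma mat_binomial_exponent_1 [simp]: "mat_binomial 1 Y = mat 1 + Y"
  by (simp add: mat_binomial_def linear_add[OF linear_matrix_of_endo])

lemma mat_binomial_0 [simp]: "mat_binomial a 0 = mat 1"
  by (simp add: mat_binomial_def endo_of_matrix_simps)

lemma mat_exp_0 [simp]: "mat_exp 0 = mat 1"
  by (simp add: mat_exp_eq endo_of_matrix_simps)

lemma mat_log_series_0 [simp]: "mat_log_series 0 = 0"
  by (simp add: mat_log_series_def endo_of_matrix_simps linear_0[OF linear_matrix_of_endo])

lemma mat_exp_log_series:
  "operator_norm Y < 1 \<Longrightarrow> mat_exp (mat_log_series Y) = mat 1 + Y"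
  by (simp add: mat_exp_eq mat_log_series_def exp_log_series operator_norm_def linear_add[OF linear_matrix_of_endo])

lemma mat_exp_minus_mult: "mat_exp (- A) ** mat_exp A = mat 1" "mat_exp A ** mat_exp (- A) = mat 1"
proof -
  show "mat_exp A ** mat_exp (- A) = mat 1" for A :: "real^'a^'a"
    by (simp add: mat_exp_eq matrix_of_endo_mult[symmetric] endo_of_matrix_simps exp_minus_inverse)
  from this[of "- A"] show "mat_exp (- A) ** mat_exp A = mat 1" by simp
qed

lemma mat_exp_inj:
  "mat_exp A = mat_exp B \<Longrightarrow> operator_norm A \<le> 1/2 \<Longrightarrow> operator_norm B \<le> 1/2 \<Longrightarrow> A = B"
  using exp_inj_near_0[of "endo_of_matrix A" "endo_of_matrix B"]
  by (simp add: mat_exp_eq operator_norm_def)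

section \<open>Square roots of positive definite matrices\<close>

lemma symmetric_inner_swap:
  fixes G :: "real^'p^'p"
  assumes "transpose G = G"
  shows "x \<bullet> (G *v y) = (G *v x) \<bullet> y"
  using dot_lmul_matrix[of x G y] transpose_matrix_vector[of G x] assms by simp

text \<open>The matrix is the square of the symmetric invertible matrix with exponent \<open>a / 2\<close>.\<close>

lemma pos_def_matrix_mat_binomial:
  assumes "operator_norm Y < 1" "transpose Y = Y"
  shows "pos_def_matrix (mat_binomial a Y)"
proof -
  let ?G = "mat_binomial (a / 2) Y"
  have G: "transpose ?G = ?G" using assms by (simp add: transpose_mat_binomial)
  have GG: "mat_binomial a Y = ?G ** ?G" using assms by (simp add: mat_binomial_mult)
  have inv: "mat_binomial (- (a / 2)) Y ** ?G = mat 1" using assms by (simp add: mat_binomial_mult)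
  have "0 < x \<bullet> (mat_binomial a Y *v x)" if "x \<noteq> 0" for x
  proof -
    have "x \<bullet> (mat_binomial a Y *v x) = (?G *v x) \<bullet> (?G *v x)"
      unfolding GG matrix_vector_mul_assoc[symmetric] by (rule symmetric_inner_swap[OF G])
    moreover have "?G *v x \<noteq> 0"
    proof
      assume "?G *v x = 0"
      then have "mat_binomial (- (a / 2)) Y *v (?G *v x) = 0" by simp
      then show False using that by (simp add: matrix_vector_mul_assoc inv)
    qed
    ultimately show ?thesis by simp
  qed
  moreover have "transpose (mat_binomial a Y) = mat_binomial a Y"
    using assms by (simp add: transpose_mat_binomial)
  ultimately show ?thesis unfolding pos_def_matrix_def by blast
qed

lemma trace_conjugate:
  fixes P D :: "real^'p^'p"
  assumes "transpose D = D"
  shows "trace (D ** P ** D) = (\<Sum>i\<in>UNIV. (D *v axis i 1) \<bullet> (P *v (D *v axis i 1)))"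
proof -
  have "(D ** P ** D) $ i $ i = (D *v axis i 1) \<bullet> (P *v (D *v axis i 1))" for i
  proof -
    have "(D ** P ** D) $ i $ i = axis i 1 \<bullet> ((D ** P ** D) *v axis i 1)"
      by (simp add: matrix_vector_mult_basis column_def inner_axis')
    also have "\<dots> = (D *v axis i 1) \<bullet> (P *v (D *v axis i 1))"
      unfolding matrix_vector_mul_assoc[symmetric] by (rule symmetric_inner_swap[OF assms])
    finally show ?thesis .
  qed
  then show ?thesis by (simp add: trace_def)
qed

text \<open>For \<open>D = P - Q\<close> the hypothesis gives \<open>P D + D Q = 0\<close>. Multiplying by \<open>D\<close> from the left and taking
  traces yields \<open>tr(D P D) + tr(D Q D) = 0\<close> with both traces nonnegative, which forces \<open>D = 0\<close>.\<close>

lemma pos_def_sqrt_unique: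
  fixes P Q :: "real^'p^'p"
  assumes P: "pos_def_matrix P" and Q: "pos_def_matrix Q" and eq: "P ** P = Q ** Q"
  shows "P = Q"
proof -
  define D where "D = P - Q"
  have D: "transpose D = D"
    using P Q unfolding D_def pos_def_matrix_def by (simp add: transpose_def vec_eq_iff)
  have "P ** D + D ** Q = 0"
    unfolding D_def using eq by (simp add: matrix_mult_diff)
  then have "D ** (P ** D + D ** Q) = 0" by simp
  then have "D ** P ** D + D ** D ** Q = 0"
    by (simp add: matrix_add_ldistrib matrix_mul_assoc)
  then have "trace (D ** P ** D) + trace (D ** D ** Q) = 0"
    by (metis trace_0 trace_add mat_0)
  then have "trace (D ** P ** D) + trace (D ** Q ** D) = 0"
    by (metis matrix_mul_assoc trace_mul_sym)
  moreover have nn: "0 \<le> (D *v axis i 1) \<bullet> (M *v (D *v axis i 1))" if "pos_def_matrix M" for i and M :: "real^'p^'p"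
    using that unfolding pos_def_matrix_def by (cases "D *v axis i 1 = 0") (auto intro: less_imp_le)
  ultimately have "(\<Sum>i\<in>UNIV. (D *v axis i 1) \<bullet> (P *v (D *v axis i 1))) = 0"
    unfolding trace_conjugate[OF D]
    using sum_nonneg[of UNIV "\<lambda>i. (D *v axis i 1) \<bullet> (P *v (D *v axis i 1))"]
      sum_nonneg[of UNIV "\<lambda>i. (D *v axis i 1) \<bullet> (Q *v (D *v axis i 1))"] nn P Q
    by (smt (verit))
  then have "(D *v axis i 1) \<bullet> (P *v (D *v axis i 1)) = 0" for i
    using nn[OF P] by (subst (asm) sum_nonneg_eq_0_iff) auto
  then have "D *v axis i 1 = 0" for i
    using P unfolding pos_def_matrix_def by (metis less_irrefl)
  then have "column i D = 0" for i by (simp add: matrix_vector_mult_basis)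
  then have "D = 0" by (simp add: column_def vec_eq_iff)
  then show ?thesis by (simp add: D_def)
qed

lemma mat_binomial_half:
  assumes "operator_norm Y < 1" "transpose Y = Y"
    and "pos_def_matrix P" "P ** P = mat 1 + Y"
  shows "mat_binomial (1/2) Y = P"
  by (rule pos_def_sqrt_unique[OF pos_def_matrix_mat_binomial[OF assms(1,2)] assms(3)])
     (simp add: mat_binomial_mult assms)

lemma mat_binomial_inverse:
  assumes "operator_norm Y < 1"
  shows "mat_binomial (- a) Y ** mat_binomial a Y = mat 1" "mat_binomial a Y ** mat_binomial (- a) Y = mat 1"
  using assms by (simp_all add: mat_binomial_mult)

lemma matrix_inv_eqI:
  fixes A B :: "real^'p^'p"
  assumes "A ** B = mat 1" "B ** A = mat 1"
  shows "matrix_inv A = B"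
proof -
  have "A ** matrix_inv A = mat 1 \<and> matrix_inv A ** A = mat 1"
    unfolding matrix_inv_def by (rule someI[of _ B]) (use assms in blast)
  then have "matrix_inv A = (B ** A) ** matrix_inv A" "B ** (A ** matrix_inv A) = B"
    using assms by simp_all
  then show ?thesis by (simp add: matrix_mul_assoc)
qed

lemma spd_inv_sqrt_eq:
  assumes "operator_norm Y < 1" "transpose Y = Y"
  shows "spd_inv_sqrt (mat 1 + Y) = mat_binomial (- (1/2)) Y"
proof -
  have "spd_sqrt (mat 1 + Y) = mat_binomial (1/2) Y"
    unfolding spd_sqrt_def
  proof (rule the_equality)
    show "pos_def_matrix (mat_binomial (1/2) Y) \<and> mat_binomial (1/2) Y ** mat_binomial (1/2) Y = mat 1 + Y"
      using assms by (simp add: pos_def_matrix_mat_binomial mat_binomial_mult)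
  qed (use mat_binomial_half[OF assms] in auto)
  then show ?thesis
    unfolding spd_inv_sqrt_def using mat_binomial_inverse[OF assms(1), of "1/2"] by (simp add: matrix_inv_eqI)
qed

section \<open>Complex eigenvalues and the principal logarithm\<close>

definition complex_matrix :: "real^'p^'p \<Rightarrow> complex^'p^'p" where
  "complex_matrix A = (\<chi> i j. complex_of_real (A $ i $ j))"

lemma complex_matrix_mult: "complex_matrix (A ** B) = complex_matrix A ** complex_matrix B"
  by (simp add: complex_matrix_def matrix_matrix_mult_def vec_eq_iff)

lemma complex_matrix_1: "complex_matrix (mat 1) = mat 1"
  by (simp add: complex_matrix_def mat_def vec_eq_iff)

lemma complex_matrix_diff: "complex_matrix (A - B) = complex_matrix A - complex_matrix B"
  by (simp add: complex_matrix_def vec_eq_iff)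

lemma complex_matrix_0 [simp]: "complex_matrix 0 = 0"
  by (simp add: complex_matrix_def vec_eq_iff)

lemma complex_matrix_eq_0 [simp]: "complex_matrix A = 0 \<longleftrightarrow> A = 0"
  by (simp add: complex_matrix_def vec_eq_iff)

lemma eigenvalues_iff:
  "c \<in> eigenvalues A \<longleftrightarrow> (\<exists>v. v \<noteq> 0 \<and> complex_matrix A *v v = c *s v)"
  by (simp add: eigenvalues_def complex_matrix_def)

lemma norm_complex_vector: "(norm v)\<^sup>2 = (norm (\<chi> i. Re (v $ i)))\<^sup>2 + (norm (\<chi> i. Im (v $ i)))\<^sup>2"
  for v :: "complex^'p"
  by (simp add: norm_vec_def L2_set_def sum_nonneg cmod_power2 sum.distrib)

text \<open>A real matrix acts on the real and imaginary parts separately.\<close>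

lemma norm_complex_matrix_vector_le: "norm (complex_matrix A *v v) \<le> operator_norm A * norm v"
proof -
  define a b where "a = (\<chi> i. Re (v $ i))" and "b = (\<chi> i. Im (v $ i))"
  have re: "(\<chi> i. Re ((complex_matrix A *v v) $ i)) = A *v a"
    and im: "(\<chi> i. Im ((complex_matrix A *v v) $ i)) = A *v b"
    by (simp_all add: complex_matrix_def matrix_vector_mult_def vec_eq_iff a_def b_def)
  have le: "(norm (A *v x))\<^sup>2 \<le> (operator_norm A)\<^sup>2 * (norm x)\<^sup>2" for x
    using norm_matrix_vector_le[of A x]
    by (metis norm_ge_zero operator_norm_def power_mono power_mult_distrib)
  have "(norm (complex_matrix A *v v))\<^sup>2 = (norm (A *v a))\<^sup>2 + (norm (A *v b))\<^sup>2"
    unfolding norm_complex_vector[of "complex_matrix A *v v"] re im ..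
  also have "\<dots> \<le> (operator_norm A)\<^sup>2 * ((norm a)\<^sup>2 + (norm b)\<^sup>2)"
    using le[of a] le[of b] by (simp add: algebra_simps)
  also have "\<dots> = (operator_norm A * norm v)\<^sup>2"
    unfolding a_def b_def norm_complex_vector[symmetric] by (simp add: power_mult_distrib)
  finally show ?thesis
    by (rule power2_le_imp_le) (simp add: operator_norm_def)
qed

lemma norm_vector_scale: "norm (c *s v) = cmod c * norm v" for v :: "complex^'p"
  by (simp add: norm_vec_def norm_mult L2_set_right_distrib)

lemma cmod_eigenvalue_le:
  assumes "c \<in> eigenvalues A"
  shows "cmod c \<le> operator_norm A"
proof -
  obtain v where v: "v \<noteq> 0" "complex_matrix A *v v = c *s v"
    using assms unfolding eigenvalues_iff by blast
  have "cmod c * norm v \<le> operator_norm A * norm v"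
    using norm_complex_matrix_vector_le[of A v] by (simp add: v norm_vector_scale)
  with v show ?thesis by simp
qed

text \<open>The vector \<open>p(X) v\<close>, by the Horner scheme.\<close>

definition poly_act :: "complex^'p^'p \<Rightarrow> complex poly \<Rightarrow> complex^'p \<Rightarrow> complex^'p" where
  "poly_act X p v = fold_coeffs (\<lambda>a r. a *s v + X *v r) p 0"

lemma poly_act_0 [simp]: "poly_act X 0 v = 0"
  by (simp add: poly_act_def)

lemma poly_act_pCons [simp]: "poly_act X (pCons a p) v = a *s v + X *v poly_act X p v"
  by (cases "p = 0 \<and> a = 0") (auto simp: poly_act_def)

lemma poly_act_add: "poly_act X (p + q) v = poly_act X p v + poly_act X q v"
proof (induction p arbitrary: q)
  case (pCons a p)
  show ?case
    by (cases q) (simp add: pCons.IH matrix_vector_right_distrib)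
qed simp

lemma poly_act_smult: "poly_act X (smult c p) v = c *s poly_act X p v"
  by (induction p) (simp_all add: vector_scalar_commute mult.assoc)

lemma poly_act_sum: "poly_act X (\<Sum>i\<in>I. f i) v = (\<Sum>i\<in>I. poly_act X (f i) v)"
  by (induction I rule: infinite_finite_induct) (simp_all add: poly_act_add)

lemma poly_act_monom: "poly_act X (monom c n) v = c *s ((((*v) X) ^^ n) v)"
  by (induction n) (simp_all add: monom_0 monom_Suc vector_scalar_commute)

lemma poly_act_in_subspace:
  assumes "vec.subspace W" "\<And>w. w \<in> W \<Longrightarrow> X *v w \<in> W" "w \<in> W"
  shows "poly_act X p w \<in> W"
  using assms by (induction p) (auto intro: vec.subspace_0 vec.subspace_add vec.subspace_scale)

text \<open>In dimension \<open>N\<close> the \<open>N + 1\<close> vectors \<open>w, X w, \<dots>, X\<^sup>N w\<close> are linearly dependent or not even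
  distinct.\<close>

lemma annihilating_poly:
  fixes X :: "complex^'p^'p"
  shows "\<exists>p. p \<noteq> 0 \<and> poly_act X p w = 0"
proof -
  define y where "y i = (((*v) X) ^^ i) w" for i
  show ?thesis
  proof (cases "inj_on y {..CARD('p)}")
    case True
    let ?S = "y ` {..CARD('p)}"
    have "card ?S = Suc CARD('p)" using True by (simp add: card_image)
    then have "vec.dependent ?S"
      using vec.dim_subset_UNIV[of ?S]
      by (intro vec.dependent_biggerset_general) (simp add: vec.dimension_def card_cart_basis)
    then obtain u where u: "\<exists>v\<in>?S. u v \<noteq> 0" "(\<Sum>v\<in>?S. u v *s v) = 0"
      by (subst (asm) vec.dependent_finite) auto
    let ?p = "\<Sum>i\<le>CARD('p). monom (u (y i)) i"
    have "poly_act X ?p w = (\<Sum>i\<le>CARD('p). u (y i) *s y i)"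
      by (simp add: poly_act_sum poly_act_monom y_def)
    also have "\<dots> = (\<Sum>v\<in>?S. u v *s v)"
      by (simp add: sum.reindex[OF True])
    finally have "poly_act X ?p w = 0" using u by simp
    moreover obtain j where j: "j \<le> CARD('p)" "u (y j) \<noteq> 0" using u(1) by auto
    then have "coeff ?p j \<noteq> 0" by (simp add: coeff_sum)
    then have "?p \<noteq> 0" by auto
    ultimately show ?thesis by blast
  next
    case False
    then obtain i j where ij: "i \<noteq> j" "y i = y j" by (auto simp: inj_on_def)
    let ?p = "monom (1 :: complex) i + smult (-1) (monom 1 j)"
    have "poly_act X ?p w = 0"
      unfolding poly_act_add poly_act_smult poly_act_monom using ij(2) by (simp add: y_def)
    moreover have "coeff ?p i \<noteq> 0" using ij(1) by simp
    then have "?p \<noteq> 0" by (metis coeff_0)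
    ultimately show ?thesis by blast
  qed
qed

text \<open>Take a nonzero polynomial \<open>p\<close> of least degree that annihilates some nonzero \<open>w\<close> in the subspace, and
  split off a root: \<open>p = (x - c) q\<close>. By minimality \<open>q(X) w\<close> is nonzero, and it is an eigenvector for \<open>c\<close>.\<close>

lemma invariant_subspace_eigenvector:
  fixes X :: "complex^'p^'p"
  assumes W: "vec.subspace W" "\<And>w. w \<in> W \<Longrightarrow> X *v w \<in> W" and w0: "w0 \<in> W" "w0 \<noteq> 0"
  shows "\<exists>w\<in>W. w \<noteq> 0 \<and> (\<exists>c. X *v w = c *s w)"
proof -
  define P where "P k \<longleftrightarrow> (\<exists>p w. p \<noteq> 0 \<and> degree p = k \<and> w \<in> W \<and> w \<noteq> 0 \<and> poly_act X p w = 0)" for k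
  have "\<exists>k. P k" using annihilating_poly[of X w0] w0 unfolding P_def by blast
  then have "P (LEAST k. P k)" by (rule LeastI_ex)
  then obtain p w where p: "p \<noteq> 0" "degree p = (LEAST k. P k)" and w: "w \<in> W" "w \<noteq> 0" "poly_act X p w = 0"
    unfolding P_def by blast
  have "degree p \<noteq> 0"
  proof
    assume "degree p = 0"
    then obtain a where a: "p = [:a:]" by (meson degree_eq_zeroE)
    with w(3) have "a *s w = 0" by simp
    with a p(1) w(2) show False by (simp add: vec.scale_eq_0_iff)
  qed
  then have "\<not> constant (poly p)" by (simp add: constant_degree)
  then obtain c where "poly p c = 0" using fundamental_theorem_of_algebra by blast
  then obtain q where q: "p = [:- c, 1:] * q" unfolding poly_eq_0_iff_dvd by (rule dvdE)
  then have "q \<noteq> 0" using p(1) by auto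
  then have "degree q < (LEAST k. P k)"
    unfolding p(2)[symmetric] q by (subst degree_mult_eq) auto
  then have "\<not> P (degree q)" by (rule not_less_Least)
  then have "poly_act X q w \<noteq> 0" using \<open>q \<noteq> 0\<close> w unfolding P_def by blast
  moreover have "poly_act X q w \<in> W" by (rule poly_act_in_subspace[OF W w(1)])
  moreover have "p = pCons 0 q + smult (- c) q" unfolding q by (simp add: mult_pCons_left)
  then have "poly_act X (pCons 0 q + smult (- c) q) w = 0"
    using w(3) by (simp only:)
  then have "X *v poly_act X q w = c *s poly_act X q w"
    unfolding poly_act_add poly_act_smult poly_act_pCons by simp
  ultimately show ?thesis by blast
qed

text \<open>The entire function \<open>\<phi>(y) = (exp y - 1) / y\<close> makes sense in every Banach algebra. Below it is used both
  for matrices and for their eigenvalues.\<close>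

lemma times_power_series_expm1:
  fixes y :: "'a::{real_normed_algebra_1,banach}"
  shows "y * power_series (\<lambda>n. inverse (fact (Suc n))) y = exp y - 1"
    and "converges_below K (\<lambda>n. inverse (fact (Suc n)))"
proof -
  show c: "converges_below K (\<lambda>n. inverse (fact (Suc n)))" for K
    unfolding converges_below_def
  proof safe
    fix r :: real assume r: "0 \<le> r"
    show "summable (\<lambda>n. \<bar>inverse (fact (Suc n))\<bar> * r ^ n)"
    proof (rule summable_comparison_test)
      show "summable (\<lambda>n. inverse (fact n) * r ^ n)" by (rule summable_exp)
      show "\<exists>N. \<forall>n\<ge>N. norm (\<bar>inverse (fact (Suc n))\<bar> * r ^ n) \<le> inverse (fact n) * r ^ n"
        using r by (auto intro!: mult_right_mono le_imp_inverse_le fact_mono simp del: fact_Suc)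
    qed
  qed
  have "(\<lambda>n. y * (inverse (fact (Suc n)) *\<^sub>R y ^ n)) sums (y * power_series (\<lambda>n. inverse (fact (Suc n))) y)"
    by (intro sums_mult power_series_sums[OF c less_add_one])
  moreover have "(\<lambda>n. y ^ Suc n /\<^sub>R fact (Suc n)) sums (exp y - 1)"
    using exp_converges[of y] sums_Suc_iff[of "\<lambda>n. y ^ n /\<^sub>R fact n"] by simp
  ultimately show "y * power_series (\<lambda>n. inverse (fact (Suc n))) y = exp y - 1"
    by (intro sums_unique2) (simp_all del: fact_Suc)
qed

lemma power_series_eigenvector:
  assumes c: "converges_below K co" "norm z < K" "cmod c < K"
    and w: "complex_matrix (matrix_of_endo z) *v w = c *s w"
  shows "complex_matrix (matrix_of_endo (power_series co z)) *v w = power_series co c *s w"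
proof -
  have pow: "complex_matrix (matrix_of_endo (z ^ n)) *v w = c ^ n *s w" for n
  proof (induction n)
    case (Suc n)
    have "complex_matrix (matrix_of_endo (z ^ Suc n)) *v w
      = complex_matrix (matrix_of_endo z) *v (complex_matrix (matrix_of_endo (z ^ n)) *v w)"
      by (simp add: matrix_of_endo_mult complex_matrix_mult matrix_vector_mul_assoc)
    then show ?case by (simp add: Suc vector_scalar_commute w vector_smult_assoc mult.commute)
  qed (simp add: complex_matrix_1)
  let ?L = "\<lambda>A. complex_matrix A *v w"
  have "linear ?L"
    by (intro linearI)
      (simp_all add: complex_matrix_def matrix_vector_mult_def vec_eq_iff sum.distrib[symmetric] algebra_simps scaleR_conv_of_real[where 'a = complex] sum_distrib_left)
  then have L: "bounded_linear (\<lambda>a. ?L (matrix_of_endo a))"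
    unfolding linear_conv_bounded_linear by (rule bounded_linear_compose[OF _ bounded_linear_matrix_of_endo])
  have "linear (\<lambda>c. c *s w)"
    by (intro linearI) (simp_all add: vec_eq_iff algebra_simps)
  then have R: "bounded_linear (\<lambda>c. c *s w)" unfolding linear_conv_bounded_linear .
  have "?L (matrix_of_endo (co n *\<^sub>R z ^ n)) = (co n *\<^sub>R c ^ n) *s w" for n
    using linear_scale[OF bounded_linear.linear[OF L], of "co n" "z ^ n"]
      linear_scale[OF bounded_linear.linear[OF R], of "co n" "c ^ n"] by (simp add: pow)
  then show ?thesis
    using bounded_linear.sums[OF L power_series_sums[OF c(1,2)]]
      bounded_linear.sums[OF R power_series_sums[OF c(1,3)]]
    by (simp add: sums_unique2)
qed

lemma complex_matrix_commute:
  "x * y = y * x \<Longrightarrow> complex_matrix (matrix_of_endo x) *v (complex_matrix (matrix_of_endo y) *v w) =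
     complex_matrix (matrix_of_endo y) *v (complex_matrix (matrix_of_endo x) *v w)"
  by (simp add: matrix_vector_mul_assoc complex_matrix_mult[symmetric] matrix_of_endo_mult[symmetric])

text \<open>Let \<open>z = x - a\<close> and \<open>M = \<phi>(z)\<close> with \<open>\<phi>(z) = (exp z - 1) / z\<close>. Then \<open>z M = exp z - 1 = 0\<close>, so \<open>M\<close> vanishes on
  the range of \<open>z\<close>. If \<open>z \<noteq> 0\<close>, this range is a nonzero subspace invariant under the commuting
  matrices \<open>x\<close> and \<open>a\<close>, hence contains a common eigenvector, with eigenvalues \<open>c\<close> and \<open>d\<close> say. Now
  \<open>\<phi>(c - d) = 0\<close>, that is, \<open>c - d\<close> is a nonzero multiple of \<open>2\<pi>i\<close>, but the imaginary parts of \<open>c\<close> and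
  \<open>d\<close> differ by less than \<open>2\<pi>\<close>.\<close>

lemma commuting_logarithms_eq:
  fixes x a :: "'p::finite endo"
  assumes exp: "exp x = exp a" and comm: "x * a = a * x"
    and x: "\<And>c. c \<in> eigenvalues (matrix_of_endo x) \<Longrightarrow> \<bar>Im c\<bar> < pi"
    and a: "\<And>c. c \<in> eigenvalues (matrix_of_endo a) \<Longrightarrow> \<bar>Im c\<bar> < pi"
  shows "x = a"
proof (rule ccontr)
  assume "x \<noteq> a"
  define z where "z = x - a"
  define M where "M = power_series (\<lambda>n. inverse (fact (Suc n))) z"
  let ?C = "\<lambda>b. complex_matrix (matrix_of_endo (b :: 'p endo))"
  have xz: "x * z = z * x" and az: "a * z = z * a"
    unfolding z_def using comm by (simp_all add: algebra_simps)
  have "exp z = exp x * exp (- a)"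
    unfolding z_def using exp_add_commuting[of x "- a"] comm by simp
  also have "\<dots> = 1" unfolding exp by (rule exp_minus_inverse)
  finally have "z * M = 0" unfolding M_def times_power_series_expm1 by simp
  moreover have "M * z = z * M"
    unfolding M_def by (rule power_series_commute[OF times_power_series_expm1(2) less_add_one]) simp
  ultimately have Mz: "M * z = 0" by simp
  define W where "W = range (\<lambda>v. ?C z *v v)"
  have W: "vec.subspace W"
    unfolding W_def by (intro vec.linear_subspace_image matrix_vector_mul_linear_gen vec.subspace_UNIV)
  have Winv: "?C b *v w \<in> W" if "b * z = z * b" "w \<in> W" for b w
    using that complex_matrix_commute[OF that(1)] unfolding W_def by auto
  have "?C z \<noteq> 0"
    using \<open>x \<noteq> a\<close> matrix_of_endo_inject[of z 0] unfolding linear_0[OF linear_matrix_of_endo]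
    by (simp add: z_def)
  then obtain v where "?C z *v v \<noteq> 0"
    by (metis matrix_eq matrix_vector_mult_0)
  then obtain w where "w \<in> W" "w \<noteq> 0" unfolding W_def by blast
  from invariant_subspace_eigenvector[OF W Winv[OF xz] this]
  obtain c w1 where w1: "w1 \<in> W" "w1 \<noteq> 0" "?C x *v w1 = c *s w1" by blast
  define W1 where "W1 = {w \<in> W. ?C x *v w = c *s w}"
  have W1: "vec.subspace W1"
    unfolding W1_def vec.subspace_def
    using W by (auto simp: vec.subspace_def matrix_vector_right_distrib vector_scalar_commute vec.scale_right_distrib)
  have W1inv: "?C a *v w \<in> W1" if "w \<in> W1" for w
    using that Winv[OF az] complex_matrix_commute[OF comm, of w]
    unfolding W1_def by (simp add: vector_scalar_commute)
  have "w1 \<in> W1" using w1 by (simp add: W1_def)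
  from invariant_subspace_eigenvector[OF W1 W1inv this w1(2)]
  obtain d w where w: "w \<in> W1" "w \<noteq> 0" "?C a *v w = d *s w" by blast
  have xw: "?C x *v w = c *s w" and "w \<in> W" using w(1) by (auto simp: W1_def)
  have zw: "?C z *v w = (c - d) *s w"
    unfolding z_def using xw w(3)
    by (simp add: linear_diff[OF linear_matrix_of_endo] complex_matrix_diff matrix_vector_mult_diff_rdistrib)
  have "?C M *v w = 0"
  proof -
    obtain u where "w = ?C z *v u" using \<open>w \<in> W\<close> unfolding W_def by blast
    then have "?C M *v w = ?C (M * z) *v u"
      by (simp add: matrix_vector_mul_assoc complex_matrix_mult[symmetric] matrix_of_endo_mult)
    then show ?thesis by (simp add: Mz linear_0[OF linear_matrix_of_endo])
  qed
  moreover have "?C M *v w = power_series (\<lambda>n. inverse (fact (Suc n))) (c - d) *s w"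
    unfolding M_def
    by (rule power_series_eigenvector[where K = "max (norm z) (cmod (c - d)) + 1", OF times_power_series_expm1(2) _ _ zw]) auto
  ultimately have 0: "power_series (\<lambda>n. inverse (fact (Suc n))) (c - d) = 0"
    using w(2) by (simp add: vec.scale_eq_0_iff)
  (* The value of the series at 0 is its constant coefficient 1. *)
  then have "c \<noteq> d" by auto
  have "exp (c - d) = 1" using times_power_series_expm1(1)[of "c - d"] 0 by simp
  then obtain n :: int where n: "Re (c - d) = 0" "Im (c - d) = of_int (2 * n) * pi"
    unfolding exp_eq_1 by blast
  have "\<bar>Im c\<bar> < pi" "\<bar>Im d\<bar> < pi"
    using x a xw w(2,3) unfolding eigenvalues_iff by blast+
  then have "\<bar>of_int (2 * n) * pi\<bar> < 2 * pi" using n(2) by simp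
  then have "n = 0" by (simp add: abs_mult)
  with n \<open>c \<noteq> d\<close> show False by (simp add: complex_eq_iff)
qed

text \<open>A matrix \<open>X\<close> with \<open>exp X = R\<close> commutes with \<open>R\<close> and therefore with the logarithmic series in \<open>R - I\<close>.\<close>

lemma mat_log_eq:
  assumes R: "operator_norm (R - mat 1) < 1" and A: "operator_norm (mat_log_series (R - mat 1)) < pi"
  shows "mat_log R = mat_log_series (R - mat 1)"
  unfolding mat_log_def
proof (rule the_equality)
  let ?A = "mat_log_series (R - mat 1)"
  have exp: "mat_exp ?A = R" using mat_exp_log_series[OF R] by simp
  have strip: "\<bar>Im c\<bar> < pi" if "c \<in> eigenvalues ?A" for c
    using cmod_eigenvalue_le[OF that] abs_Im_le_cmod[of c] A by linarith
  then show "mat_exp ?A = R \<and> (\<forall>c\<in>eigenvalues ?A. - pi < Im c \<and> Im c < pi)"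
    using exp by (force simp: abs_less_iff)
  fix X assume X: "mat_exp X = R \<and> (\<forall>c\<in>eigenvalues X. - pi < Im c \<and> Im c < pi)"
  let ?x = "endo_of_matrix X" and ?a = "endo_of_matrix ?A"
  have ex: "exp ?x = endo_of_matrix R" using X by (auto simp: mat_exp_eq)
  have ea: "exp ?a = endo_of_matrix R" using exp by (metis mat_exp_eq endo_of_matrix_of_endo)
  have "exp ?x * ?x = ?x * exp ?x"
    unfolding exp_power_series by (rule power_series_commute[OF converges_below_exp less_add_one]) simp
  then have "(exp ?x - 1) * ?x = ?x * (exp ?x - 1)" by (simp add: algebra_simps)
  moreover have "exp ?x - 1 = endo_of_matrix (R - mat 1)" by (simp add: ex endo_of_matrix_simps)
  ultimately have comm: "endo_of_matrix (R - mat 1) * ?x = ?x * endo_of_matrix (R - mat 1)"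
    by (simp only:)
  have "?a * ?x = ?x * ?a"
    unfolding mat_log_series_def log_series_def endo_of_matrix_of_endo
    by (rule power_series_commute[OF converges_below_log R[unfolded operator_norm_def] comm])
  then have ax: "?x * ?a = ?a * ?x" by (rule sym)
  have "?x = ?a"
  proof (rule commuting_logarithms_eq[OF _ ax])
    show "exp ?x = exp ?a" by (simp only: ex ea)
    show "\<bar>Im c\<bar> < pi" if "c \<in> eigenvalues (matrix_of_endo ?x)" for c
      using X that by (force simp: abs_less_iff)
  qed (simp_all add: strip)
  then show "X = ?A" by simp
qed

section \<open>The dimension of the tangent space\<close>

lemma dim_eq_card_orthogonal_family:
  fixes f :: "'i \<Rightarrow> 'a::euclidean_space"
  assumes "finite I" "subspace V" "f ` I \<subseteq> V"
    and nz: "\<And>a. a \<in> I \<Longrightarrow> f a \<noteq> 0"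
    and orth: "\<And>a b. a \<in> I \<Longrightarrow> b \<in> I \<Longrightarrow> a \<noteq> b \<Longrightarrow> f a \<bullet> f b = 0"
    and total: "\<And>x. x \<in> V \<Longrightarrow> (\<And>a. a \<in> I \<Longrightarrow> f a \<bullet> x = 0) \<Longrightarrow> x = 0"
  shows "dim V = card I"
proof -
  have inj: "inj_on f I"
    using nz orth by (metis inj_onI inner_eq_zero_iff)
  have "independent (f ` I)"
    by (rule pairwise_orthogonal_independent)
       (use nz orth in \<open>auto simp: pairwise_def orthogonal_def\<close>)
  moreover have "V \<subseteq> span (f ` I)"
  proof
    fix x assume x: "x \<in> V"
    obtain y z where y: "y \<in> span (f ` I)" and z: "\<And>w. w \<in> span (f ` I) \<Longrightarrow> orthogonal z w" and eq: "x = y + z"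
      using orthogonal_subspace_decomp_exists[of "f ` I" x] by blast
    have "y \<in> V" using y span_minimal[OF assms(3,2)] by blast
    then have "z \<in> V" using subspace_diff[OF assms(2) x, of y] eq by simp
    moreover have "f a \<bullet> z = 0" if "a \<in> I" for a
      using z[OF span_base, of "f a"] that by (simp add: orthogonal_def inner_commute)
    ultimately have "z = 0" by (rule total)
    with y eq show "x \<in> span (f ` I)" by simp
  qed
  ultimately have "card (f ` I) = dim V"
    by (intro basis_card_eq_dim assms(3))
  then show ?thesis by (simp add: card_image[OF inj])
qed

text \<open>The off-diagonal pairs split into two halves exchanged by swapping the coordinates.\<close>

lemma card_increasing_pairs:
  fixes e :: "'p::finite \<Rightarrow> nat"
  assumes "inj e"
  shows "card {(i, j). e i < e j} = CARD('p) * (CARD('p) - 1) div 2"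
proof -
  let ?L = "{(i, j). e i < e j}" and ?D = "(\<lambda>i. (i, i)) ` (UNIV :: 'p set)"
  have "(UNIV :: ('p \<times> 'p) set) = (?L \<union> prod.swap ` ?L) \<union> ?D"
    using assms by (auto simp: image_iff inj_eq not_less_iff_gr_or_eq)
  then have "card (UNIV :: ('p \<times> 'p) set) = card ((?L \<union> prod.swap ` ?L) \<union> ?D)"
    by (simp only:)
  also have "\<dots> = card (?L \<union> prod.swap ` ?L) + card ?D"
    by (intro card_Un_disjoint) auto
  also have "card (?L \<union> prod.swap ` ?L) = card ?L + card (prod.swap ` ?L)"
    by (intro card_Un_disjoint) auto
  also have "card (prod.swap ` ?L) = card ?L"
    by (intro card_image) simp
  also have "card ?D = CARD('p)"
    by (intro card_image) (simp add: inj_on_def)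
  finally have "CARD('p) * CARD('p) = 2 * card ?L + CARD('p)" by simp
  then show ?thesis by (simp add: diff_mult_distrib2)
qed

lemma upper_block_stack [simp]: "inj \<iota> \<Longrightarrow> upper_block \<iota> (stack_blocks \<iota> A B) = A"
  by (simp add: upper_block_def stack_blocks_def vec_eq_iff)

lemma lower_block_stack [simp]: "lower_block \<iota> (stack_blocks \<iota> A B) = lower_block \<iota> B"
  by (simp add: lower_block_def stack_blocks_def vec_eq_iff)

lemma stack_upper_lower [simp]:
  "inj \<iota> \<Longrightarrow> stack_blocks \<iota> (upper_block \<iota> U) (lower_block \<iota> U) = U"
  by (auto simp: upper_block_def lower_block_def stack_blocks_def vec_eq_iff f_inv_into_f)

lemma lower_block_mult [simp]:
  "lower_block \<iota> (lower_block \<iota> U ** S) = lower_block \<iota> U ** S"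
  by (simp add: lower_block_def vec_eq_iff matrix_matrix_mult_def)

lemma tangent_space_E_iff: "inj \<iota> \<Longrightarrow> x \<in> tangent_space_E \<iota> \<longleftrightarrow> skew_matrix (upper_block \<iota> x)"
  unfolding tangent_space_E_def by (auto, metis stack_upper_lower)

lemma linear_upper_block: "linear (upper_block \<iota> :: real^'p^'n \<Rightarrow> real^'p^'p)"
  by (intro linearI) (simp_all add: upper_block_def vec_eq_iff)

lemma linear_lower_block: "linear (lower_block \<iota> :: real^'p^'n \<Rightarrow> real^'p^'n)"
  by (intro linearI) (simp_all add: lower_block_def vec_eq_iff)

lemma subspace_tangent_space_E: "inj \<iota> \<Longrightarrow> subspace (tangent_space_E \<iota>)"
  unfolding subspace_def
  by (simp add: tangent_space_E_iff skew_matrix_def linear_0[OF linear_upper_block] linear_0[OF linear_transpose]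
      linear_add[OF linear_upper_block] linear_add[OF linear_transpose]
      linear_scale[OF linear_upper_block] linear_scale[OF linear_transpose])

lemma inner_axis_axis: "axis k (axis j 1) \<bullet> x = x $ k $ j" for x :: "real^'p^'n"
  by (simp add: inner_axis')

lemma axis_axis_component:
  "(axis k (axis j 1) :: real^'p^'n) $ k' $ j' = (if k' = k \<and> j' = j then 1 else 0)"
  by (cases "k' = k") (simp_all add: axis_def)

text \<open>The matrices \<open>e\<^sub>i\<^sub>j - e\<^sub>j\<^sub>i\<close> with \<open>i < j\<close> in the upper block, for an auxiliary enumeration of the column
  indices, together with the matrix units of the lower block form an orthogonal basis.\<close>

lemma dim_tangent_space_E:
  fixes \<iota> :: "'p::finite \<Rightarrow> 'n::finite"
  assumes \<iota>: "inj \<iota>"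
  shows "dim (tangent_space_E \<iota>) =
    CARD('p) * (CARD('p) - 1) div 2 + (CARD('n) - CARD('p)) * CARD('p)"
proof -
  obtain e :: "'p \<Rightarrow> nat" where e: "inj e"
    using finite_imp_inj_to_nat_seg[of "UNIV :: 'p set"] by auto
  define I where "I = {(i, j). e i < e j} <+> (- range \<iota>) \<times> (UNIV :: 'p set)"
  define f :: "'p \<times> 'p + 'n \<times> 'p \<Rightarrow> real^'p^'n" where
    "f = case_sum (\<lambda>(i, j). axis (\<iota> i) (axis j 1) - axis (\<iota> j) (axis i 1)) (\<lambda>(k, j). axis k (axis j 1))"
  have f: "f (Inl (i, j)) \<bullet> x = x $ \<iota> i $ j - x $ \<iota> j $ i" "f (Inr (k, j)) \<bullet> x = x $ k $ j" for i j k x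
    by (simp_all add: f_def inner_diff_left inner_axis_axis)
  have fc: "f (Inl (i, j)) $ k $ l = (if k = \<iota> i \<and> l = j then 1 else 0) - (if k = \<iota> j \<and> l = i then 1 else 0)"
    "f (Inr (m, j)) $ k $ l = (if k = m \<and> l = j then 1 else 0)" for i j k l m
    by (simp_all only: f_def sum.case prod.case vector_minus_component axis_axis_component)
  have "dim (tangent_space_E \<iota>) = card I"
  proof (rule dim_eq_card_orthogonal_family)
    show "finite I" by (simp add: I_def)
    show "subspace (tangent_space_E \<iota>)" by (rule subspace_tangent_space_E[OF \<iota>])
    have inj: "\<iota> i = \<iota> j \<longleftrightarrow> i = j" for i j using \<iota> by (rule inj_eq)
    have cases: "(\<exists>i j. a = Inl (i, j) \<and> e i < e j) \<or> (\<exists>k j. a = Inr (k, j) \<and> (\<forall>i. \<iota> i \<noteq> k))"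
      if "a \<in> I" for a using that unfolding I_def by auto
    show "f ` I \<subseteq> tangent_space_E \<iota>"
    proof (rule image_subsetI)
      fix a assume "a \<in> I"
      have swap: "f a $ \<iota> l $ k = - (f a $ \<iota> k $ l)" for k l
        using cases[OF \<open>a \<in> I\<close>]
      proof (elim disjE exE conjE)
        fix i j assume "a = Inl (i, j)"
        then show ?thesis
          by (simp only: fc inj) (cases "l = i"; cases "k = j"; cases "l = j"; cases "k = i"; simp)
      qed (simp add: fc)
      have "transpose (upper_block \<iota> (f a)) = - upper_block \<iota> (f a)"
        unfolding vec_eq_iff upper_block_def transpose_def vec_lambda_beta vector_uminus_component
        by (intro allI swap)
      then show "f a \<in> tangent_space_E \<iota>"
        using \<iota> by (simp only: tangent_space_E_iff skew_matrix_def)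
    qed
    show "f a \<noteq> 0" if "a \<in> I" for a
    proof -
      have "f a \<bullet> f a \<noteq> 0"
        using cases[OF that]
      proof (elim disjE exE conjE)
        fix i j assume "a = Inl (i, j)" "e i < e j"
        moreover from this have "i \<noteq> j" "j \<noteq> i" by auto
        ultimately show ?thesis by (simp add: f fc inj)
      qed (simp add: f fc)
      then show ?thesis by auto
    qed
    show "f a \<bullet> f b = 0" if "a \<in> I" "b \<in> I" "a \<noteq> b" for a b
      using cases[OF that(1)] cases[OF that(2)]
    proof (elim disjE exE conjE)
      fix i j k l assume ab: "a = Inl (i, j)" "e i < e j" "b = Inl (k, l)" "e k < e l"
      then have "\<not> (i = k \<and> j = l)" "\<not> (i = l \<and> j = k)" "\<not> (j = k \<and> i = l)" "\<not> (j = l \<and> i = k)"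
        using that(3) by auto
      then show ?thesis by (simp only: ab f fc inj if_False diff_self)
    next
      fix i j k l assume ab: "a = Inl (i, j)" "b = Inr (k, l)" "\<forall>i. \<iota> i \<noteq> k"
      then show ?thesis by (simp add: f fc)
    next
      fix i j k l assume ab: "b = Inl (i, j)" "a = Inr (k, l)" "\<forall>i. \<iota> i \<noteq> k"
      from ab(3) have "k \<noteq> \<iota> i" for i by metis
      then show ?thesis by (simp add: f fc ab(1,2))
    next
      fix i j k l assume ab: "a = Inr (i, j)" "b = Inr (k, l)"
      with that(3) have "\<not> (i = k \<and> j = l)" by auto
      then show ?thesis by (simp only: ab f fc if_False)
    qed
    fix x assume x: "x \<in> tangent_space_E \<iota>" and 0: "\<And>a. a \<in> I \<Longrightarrow> f a \<bullet> x = 0"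
    have "transpose (upper_block \<iota> x) = - upper_block \<iota> x"
      using x \<iota> by (simp add: tangent_space_E_iff skew_matrix_def)
    then have "transpose (upper_block \<iota> x) $ i $ j = (- upper_block \<iota> x) $ i $ j" for i j
      by (simp only:)
    then have skew: "x $ \<iota> j $ i = - x $ \<iota> i $ j" for i j
      unfolding upper_block_def transpose_def vec_lambda_beta vector_uminus_component .
    have lt: "x $ \<iota> i $ j = 0" if "e i < e j" for i j
    proof -
      have "Inl (i, j) \<in> I" using that by (auto simp: I_def)
      from 0[OF this] skew[of j i] show ?thesis by (simp only: f)
    qed
    have "x $ \<iota> i $ j = 0" for i j
    proof (cases "e i" "e j" rule: linorder_cases)
      case equal
      then have "i = j" using e by (simp add: inj_eq)
      moreover have "x $ \<iota> i $ i = 0" using skew[of i i] by linarith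
      ultimately show ?thesis by simp
    qed (use lt[of i j] lt[of j i] skew[of j i] in auto)
    moreover have "x $ k $ j = 0" if "k \<notin> range \<iota>" for k j
    proof -
      have "Inr (k, j) \<in> I" using that by (auto simp: I_def)
      from 0[OF this] show ?thesis by (simp only: f)
    qed
    ultimately show "x = 0"
      by (metis (no_types, lifting) rangeE vec_eq_iff zero_index)
  qed
  also have "\<dots> = CARD('p) * (CARD('p) - 1) div 2 + (CARD('n) - CARD('p)) * CARD('p)"
    by (simp add: I_def card_Plus card_cartesian_product card_increasing_pairs[OF e]
        Compl_eq_Diff_UNIV card_Diff_subset card_image[OF \<iota>])
  finally show ?thesis .
qed

section \<open>The chart and its inverse in terms of series\<close>

lemma linear_stack_blocks:
  "linear (\<lambda>A :: real^'p^'p. stack_blocks \<iota> A 0 :: real^'p^'n)" "linear (\<lambda>B :: real^'p^'n. stack_blocks \<iota> 0 B)"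
  by (intro linearI; simp add: stack_blocks_def vec_eq_iff)+

lemma transpose_mult_blocks:
  fixes \<iota> :: "'p::finite \<Rightarrow> 'n::finite"
  assumes "inj \<iota>"
  shows "transpose U ** U = transpose (upper_block \<iota> U) ** upper_block \<iota> U + transpose (lower_block \<iota> U) ** lower_block \<iota> U"
proof -
  have "(\<Sum>k\<in>UNIV. U $ k $ i * U $ k $ j) =
      (\<Sum>k\<in>UNIV. U $ \<iota> k $ i * U $ \<iota> k $ j) + (\<Sum>k\<in>UNIV. lower_block \<iota> U $ k $ i * lower_block \<iota> U $ k $ j)" for i j
  proof -
    have "(\<Sum>k\<in>UNIV. U $ k $ i * U $ k $ j) = (\<Sum>k\<in>range \<iota>. U $ k $ i * U $ k $ j) + (\<Sum>k\<in>- range \<iota>. U $ k $ i * U $ k $ j)"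
      by (subst sum.union_disjoint[symmetric]) (auto intro: sum.cong)
    also have "(\<Sum>k\<in>range \<iota>. U $ k $ i * U $ k $ j) = (\<Sum>k\<in>UNIV. U $ \<iota> k $ i * U $ \<iota> k $ j)"
      by (simp add: sum.reindex[OF assms])
    also have "(\<Sum>k\<in>- range \<iota>. U $ k $ i * U $ k $ j) = (\<Sum>k\<in>UNIV. lower_block \<iota> U $ k $ i * lower_block \<iota> U $ k $ j)"
      by (rule sum.mono_neutral_cong_left) (auto simp: lower_block_def)
    finally show ?thesis .
  qed
  then show ?thesis
    by (simp add: vec_eq_iff matrix_matrix_mult_def transpose_def upper_block_def)
qed

text \<open>The determinant is \<open>1\<close> and not \<open>-1\<close> because \<open>exp A = exp(A/2)\<^sup>2\<close>.\<close>

lemma rotation_matrix_mat_exp: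
  assumes "skew_matrix A"
  shows "rotation_matrix (mat_exp A)"
proof -
  have tr: "transpose (mat_exp A) = mat_exp (- A)"
    using assms by (simp add: transpose_mat_exp skew_matrix_def)
  then have orth: "orthogonal_matrix (mat_exp A)"
    unfolding orthogonal_matrix_def using mat_exp_minus_mult[of A] by simp
  have "endo_of_matrix ((1/2) *\<^sub>R A) + endo_of_matrix ((1/2) *\<^sub>R A) = endo_of_matrix A"
    unfolding linear_add[OF linear_endo_of_matrix, symmetric] scaleR_left.add[symmetric] by simp
  then have "mat_exp A = mat_exp ((1/2) *\<^sub>R A) ** mat_exp ((1/2) *\<^sub>R A)"
    unfolding mat_exp_eq matrix_of_endo_mult[symmetric]
    by (subst exp_add_commuting[symmetric]) simp_all
  then have "det (mat_exp A) = det (mat_exp ((1/2) *\<^sub>R A)) * det (mat_exp ((1/2) *\<^sub>R A))"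
    by (simp only: det_mul)
  then have "0 \<le> det (mat_exp A)" by simp
  moreover have "det (mat_exp A) = 1 \<or> det (mat_exp A) = - 1"
    by (rule det_orthogonal_matrix[OF orth])
  ultimately have "det (mat_exp A) = 1" by auto
  with orth show ?thesis by (simp add: rotation_matrix_def)
qed

text \<open>An eigenvalue \<open>-1\<close> of \<open>R\<close> is an eigenvalue \<open>-2\<close> of \<open>R - I\<close>.\<close>

lemma minus_1_not_eigenvalue:
  assumes "operator_norm (R - mat 1) < 1"
  shows "- 1 \<notin> eigenvalues R"
proof
  assume "- 1 \<in> eigenvalues R"
  then obtain v where v: "v \<noteq> 0" "complex_matrix R *v v = - 1 *s v"
    unfolding eigenvalues_iff by blast
  have "complex_matrix (R - mat 1) *v v = (- 2) *s v"
    unfolding complex_matrix_diff complex_matrix_1 matrix_vector_mult_diff_rdistrib v(2)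
    by (simp add: vec_eq_iff)
  with v(1) have "- 2 \<in> eigenvalues (R - mat 1)" unfolding eigenvalues_iff by blast
  from cmod_eigenvalue_le[OF this] assms show False by simp
qed

definition gram_defect :: "('p::finite \<Rightarrow> 'n::finite) \<Rightarrow> real^'p^'n \<Rightarrow> real^'p^'p" where
  "gram_defect \<iota> U = transpose (upper_block \<iota> U) ** upper_block \<iota> U - mat 1"

definition polar_factor :: "('p::finite \<Rightarrow> 'n::finite) \<Rightarrow> real^'p^'n \<Rightarrow> real^'p^'p" where
  "polar_factor \<iota> U = upper_block \<iota> U ** mat_binomial (- (1/2)) (gram_defect \<iota> U)"

text \<open>The extension of \<open>\<psi>\<close> to an open set of the ambient space that replaces the inverse square root and
  the logarithm by their series.\<close>

definition series_chart :: "('p::finite \<Rightarrow> 'n::finite) \<Rightarrow> real^'p^'n \<Rightarrow> real^'p^'n" where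
  "series_chart \<iota> U = stack_blocks \<iota> (mat_log_series (polar_factor \<iota> U - mat 1))
     (lower_block \<iota> U ** mat_binomial (- (1/2)) (gram_defect \<iota> U))"

definition series_domain :: "('p::finite \<Rightarrow> 'n::finite) \<Rightarrow> (real^'p^'n) set" where
  "series_domain \<iota> = {U. operator_norm (gram_defect \<iota> U) < 1 \<and> operator_norm (polar_factor \<iota> U - mat 1) < 1}"

definition lower_gram :: "('p::finite \<Rightarrow> 'n::finite) \<Rightarrow> real^'p^'n \<Rightarrow> real^'p^'p" where
  "lower_gram \<iota> x = transpose (lower_block \<iota> x) ** lower_block \<iota> x"

definition inverse_chart :: "('p::finite \<Rightarrow> 'n::finite) \<Rightarrow> real^'p^'n \<Rightarrow> real^'p^'n" where
  "inverse_chart \<iota> x = stack_blocks \<iota> (mat_exp (upper_block \<iota> x) ** mat_binomial (- (1/2)) (lower_gram \<iota> x))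
     (lower_block \<iota> x ** mat_binomial (- (1/2)) (lower_gram \<iota> x))"

text \<open>This form serves both directions of the chart: the positive definite root \<open>P\<close> of \<open>I + Y\<close> and its
  inverse \<open>Q\<close> are known there explicitly.\<close>

lemma inv_sqrt_of_square:
  assumes "operator_norm Y < 1" "transpose Y = Y" "pos_def_matrix P" "P ** P = mat 1 + Y" "Q ** P = mat 1"
  shows "mat_binomial (- (1/2)) Y = (Q :: real^'p^'p)"
proof -
  have half: "mat_binomial (1/2) Y = P" by (rule mat_binomial_half[OF assms(1-4)])
  have inv: "P ** mat_binomial (- (1/2)) Y = mat 1"
    using mat_binomial_inverse(2)[OF assms(1), of "1/2"] by (simp only: half)
  have "mat_binomial (- (1/2)) Y = (Q ** P) ** mat_binomial (- (1/2)) Y" by (simp add: assms(5))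
  also have "\<dots> = Q ** (P ** mat_binomial (- (1/2)) Y)" by (simp add: matrix_mul_assoc)
  also have "\<dots> = Q" by (simp add: inv)
  finally show ?thesis .
qed

text \<open>Write \<open>S = (U\<^sub>1\<^sup>T U\<^sub>1)\<^bsup>-1/2\<^esup>\<close>. The polar factor \<open>R = U\<^sub>1 S\<close> is orthogonal, so its logarithm \<open>L\<close> satisfies
  \<open>exp(L\<^sup>T) = R\<^sup>T = R\<^bsup>-1\<^esup> = exp(-L)\<close> and is skew-symmetric by local injectivity of the exponential.
  From \<open>U\<^sub>2\<^sup>T U\<^sub>2 = I - U\<^sub>1\<^sup>T U\<^sub>1\<close> one gets \<open>I + B\<^sup>T B = S\<^sup>2\<close> for \<open>B = U\<^sub>2 S\<close>, so the inverse chart multiplies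
  \<open>R\<close> and \<open>B\<close> by \<open>S\<^bsup>-1\<^esup>\<close> and recovers \<open>U\<^sub>1\<close> and \<open>U\<^sub>2\<close>.\<close>

lemma series_chart_correct:
  fixes \<iota> :: "'p::finite \<Rightarrow> 'n::finite"
  assumes \<iota>: "inj \<iota>" and U: "U \<in> stiefel" "U \<in> series_domain \<iota>"
    and A: "operator_norm (upper_block \<iota> (series_chart \<iota> U)) < 1/2"
    and B: "operator_norm (lower_gram \<iota> (series_chart \<iota> U)) < 1"
  shows "psi_E_defined \<iota> U" "psi_E \<iota> U = series_chart \<iota> U"
    "series_chart \<iota> U \<in> tangent_space_E \<iota>" "inverse_chart \<iota> (series_chart \<iota> U) = U"
proof -
  let ?u = "upper_block \<iota> U" and ?l = "lower_block \<iota> U"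
  define Y where "Y = gram_defect \<iota> U"
  define S where "S = mat_binomial (- (1/2)) Y"
  define P where "P = mat_binomial (1/2) Y"
  define R where "R = ?u ** S"
  have R: "polar_factor \<iota> U = R" by (simp add: polar_factor_def R_def S_def Y_def)
  have Y: "operator_norm Y < 1" and R1: "operator_norm (R - mat 1) < 1"
    using U(2) by (simp_all add: series_domain_def Y_def R)
  have gram: "transpose ?u ** ?u = mat 1 + Y" by (simp add: Y_def gram_defect_def)
  then have "Y = transpose ?u ** ?u - mat 1" by simp
  then have Ysym: "transpose Y = Y"
    by (simp add: linear_diff[OF linear_transpose] matrix_transpose_mul transpose_mat)
  have Ssym: "transpose S = S" unfolding S_def using transpose_mat_binomial[OF Y] Ysym by simp
  have SP: "S ** P = mat 1" "P ** S = mat 1" and PP: "P ** P = mat 1 + Y"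
    unfolding S_def P_def by (simp_all add: mat_binomial_mult[OF Y])
  have SYS: "S ** (mat 1 + Y) ** S = mat 1"
  proof -
    have "S ** (mat 1 + Y) ** S = (S ** P) ** (P ** S)" unfolding PP[symmetric] by (simp only: matrix_mul_assoc)
    then show ?thesis by (simp add: SP)
  qed
  have RR: "transpose R ** R = mat 1"
  proof -
    have "transpose R ** R = S ** (transpose ?u ** ?u) ** S"
      unfolding R_def matrix_transpose_mul Ssym by (simp only: matrix_mul_assoc)
    then show ?thesis by (simp add: gram SYS)
  qed
  define L where "L = mat_log_series (R - mat 1)"
  have chart: "series_chart \<iota> U = stack_blocks \<iota> L (?l ** S)"
    by (simp add: series_chart_def L_def R S_def Y_def)
  have upL: "upper_block \<iota> (series_chart \<iota> U) = L" by (simp add: chart \<iota>)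
  have lowB: "lower_block \<iota> (series_chart \<iota> U) = ?l ** S" by (simp add: chart)
  have L: "operator_norm L < 1/2" using A by (simp only: upL)
  have expL: "mat_exp L = R" unfolding L_def using mat_exp_log_series[OF R1] by simp
  have skew: "skew_matrix L"
    unfolding skew_matrix_def
  proof (rule mat_exp_inj)
    have "mat_exp (transpose L) = transpose R" by (simp add: transpose_mat_exp[symmetric] expL)
    also have "\<dots> = transpose R ** (R ** mat_exp (- L))" by (simp add: expL[symmetric] mat_exp_minus_mult)
    also have "\<dots> = mat_exp (- L)" by (simp add: matrix_mul_assoc RR)
    finally show "mat_exp (transpose L) = mat_exp (- L)" .
  qed (use L in simp_all)
  have inv_sqrt: "gram_inv_sqrt \<iota> U = S"
    unfolding gram_inv_sqrt_def gram S_def by (rule spd_inv_sqrt_eq[OF Y Ysym])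
  have "pos_def_matrix (transpose ?u ** ?u)"
    using pos_def_matrix_mat_binomial[OF Y Ysym, of 1] by (simp add: gram)
  moreover have "R \<in> mat_log_domain"
    unfolding mat_log_domain_def
    using rotation_matrix_mat_exp[OF skew] minus_1_not_eigenvalue[OF R1] by (simp add: expL)
  ultimately show "psi_E_defined \<iota> U"
    by (simp add: psi_E_defined_def inv_sqrt R_def)
  have "mat_log R = L"
    unfolding L_def using L pi_gt3 by (intro mat_log_eq[OF R1]) (simp add: L_def)
  then show "psi_E \<iota> U = series_chart \<iota> U"
    by (simp add: psi_E_def inv_sqrt chart R_def)
  show "series_chart \<iota> U \<in> tangent_space_E \<iota>"
    using skew by (simp add: tangent_space_E_iff[OF \<iota>] upL)
  have lg: "lower_gram \<iota> (series_chart \<iota> U) = S ** S - mat 1"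
  proof -
    have "transpose ?u ** ?u + transpose ?l ** ?l = mat 1"
      using U(1) transpose_mult_blocks[OF \<iota>, of U] by (simp add: stiefel_def)
    then have "transpose ?l ** ?l = mat 1 - transpose ?u ** ?u" by (simp add: eq_diff_eq add.commute)
    then have ll: "transpose ?l ** ?l = mat 1 - (mat 1 + Y)" by (simp only: gram)
    have "lower_gram \<iota> (series_chart \<iota> U) = S ** (transpose ?l ** ?l) ** S"
      unfolding lower_gram_def lowB matrix_transpose_mul Ssym by (simp only: matrix_mul_assoc)
    also have "\<dots> = S ** S - S ** (mat 1 + Y) ** S"
      unfolding ll matrix_mult_diff by simp
    finally show ?thesis by (simp only: SYS)
  qed
  have Y': "transpose (S ** S - mat 1) = S ** S - mat 1"
    by (simp add: linear_diff[OF linear_transpose] matrix_transpose_mul transpose_mat Ssym)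
  have "mat_binomial (- (1/2)) (S ** S - mat 1) = P"
  proof (rule inv_sqrt_of_square[OF _ Y'])
    show "operator_norm (S ** S - mat 1) < 1" using B by (simp only: lg)
    show "pos_def_matrix S" unfolding S_def by (rule pos_def_matrix_mat_binomial[OF Y Ysym])
  qed (simp_all add: SP)
  then have "inverse_chart \<iota> (series_chart \<iota> U) = stack_blocks \<iota> (R ** P) (?l ** S ** P)"
    by (simp add: inverse_chart_def lg upL lowB expL)
  also have "R ** P = ?u" unfolding R_def by (simp add: matrix_mul_assoc[symmetric] SP)
  also have "?l ** S ** P = ?l" by (simp add: matrix_mul_assoc[symmetric] SP)
  finally show "inverse_chart \<iota> (series_chart \<iota> U) = U" by (simp add: \<iota>)
qed

text \<open>Write \<open>S = (I + B\<^sup>T B)\<^bsup>-1/2\<^esup>\<close>. Since \<open>exp A\<close> is orthogonal, the upper block \<open>U\<^sub>1 = exp(A) S\<close> has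
  \<open>U\<^sub>1\<^sup>T U\<^sub>1 = S\<^sup>2\<close>, whose inverse square root is \<open>S\<^bsup>-1\<^esup>\<close>. The norm bounds keep all series within
  their domains and the logarithm within the region where the exponential is injective.\<close>

lemma inverse_chart_correct:
  fixes \<iota> :: "'p::finite \<Rightarrow> 'n::finite"
  assumes \<iota>: "inj \<iota>" and x: "x \<in> tangent_space_E \<iota>"
    and a: "operator_norm (upper_block \<iota> x) < 1/2"
    and b: "operator_norm (lower_gram \<iota> x) < 1"
    and c: "operator_norm (mat_binomial (- 1) (lower_gram \<iota> x) - mat 1) < 1"
    and d: "operator_norm (mat_exp (upper_block \<iota> x) - mat 1) < 1"
    and e: "operator_norm (mat_log_series (mat_exp (upper_block \<iota> x) - mat 1)) < 1/2"
  shows "inverse_chart \<iota> x \<in> stiefel" "inverse_chart \<iota> x \<in> series_domain \<iota>"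
    "series_chart \<iota> (inverse_chart \<iota> x) = x"
proof -
  define A where "A = upper_block \<iota> x"
  define B where "B = lower_block \<iota> x"
  define Y where "Y = lower_gram \<iota> x"
  define S where "S = mat_binomial (- (1/2)) Y"
  define P where "P = mat_binomial (1/2) Y"
  let ?e = "mat_exp A" and ?U = "inverse_chart \<iota> x"
  have Y: "operator_norm Y < 1" using b by (simp add: Y_def)
  have YB: "Y = transpose B ** B" by (simp add: Y_def B_def lower_gram_def)
  have Ysym: "transpose Y = Y" unfolding YB by (simp add: matrix_transpose_mul)
  have Ssym: "transpose S = S" unfolding S_def using transpose_mat_binomial[OF Y] Ysym by simp
  have SP: "S ** P = mat 1" "P ** S = mat 1" and PP: "P ** P = mat 1 + Y" and SS: "S ** S = mat_binomial (- 1) Y"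
    unfolding S_def P_def by (simp_all add: mat_binomial_mult[OF Y])
  have skew: "transpose A = - A" using x by (simp add: tangent_space_E_iff[OF \<iota>] skew_matrix_def A_def)
  have ee: "transpose ?e ** ?e = mat 1" by (simp add: transpose_mat_exp skew mat_exp_minus_mult)
  have U: "?U = stack_blocks \<iota> (?e ** S) (B ** S)"
    by (simp add: inverse_chart_def A_def B_def S_def Y_def)
  have up: "upper_block \<iota> ?U = ?e ** S" by (simp add: U \<iota>)
  have low: "lower_block \<iota> ?U = B ** S" unfolding U B_def by simp
  have gram: "transpose (?e ** S) ** (?e ** S) = S ** S"
  proof -
    have "transpose (?e ** S) ** (?e ** S) = S ** (transpose ?e ** ?e) ** S"
      unfolding matrix_transpose_mul Ssym by (simp only: matrix_mul_assoc)
    then show ?thesis by (simp add: ee)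
  qed
  have "transpose ?U ** ?U = S ** S + S ** Y ** S"
    unfolding transpose_mult_blocks[OF \<iota>, of ?U] up low gram
    unfolding matrix_transpose_mul Ssym YB by (simp only: matrix_mul_assoc)
  also have "\<dots> = S ** (mat 1 + Y) ** S"
    by (simp add: matrix_add_ldistrib matrix_mult_add)
  also have "\<dots> = (S ** P) ** (P ** S)" unfolding PP[symmetric] by (simp only: matrix_mul_assoc)
  finally show "?U \<in> stiefel" by (simp add: stiefel_def SP)
  have gd: "gram_defect \<iota> ?U = S ** S - mat 1"
    by (simp add: gram_defect_def up gram)
  have gd1: "operator_norm (S ** S - mat 1) < 1" using c unfolding SS Y_def .
  have Psq: "mat_binomial (- (1/2)) (S ** S - mat 1) = P"
  proof (rule inv_sqrt_of_square[OF gd1])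
    show "transpose (S ** S - mat 1) = S ** S - mat 1"
      by (simp add: linear_diff[OF linear_transpose] matrix_transpose_mul transpose_mat Ssym)
    show "pos_def_matrix S" unfolding S_def by (rule pos_def_matrix_mat_binomial[OF Y Ysym])
  qed (simp_all add: SP)
  have polar: "polar_factor \<iota> ?U = ?e"
    by (simp add: polar_factor_def gd Psq up matrix_mul_assoc[symmetric] SP)
  show "?U \<in> series_domain \<iota>"
    using gd1 d by (simp add: series_domain_def gd polar A_def)
  have log: "mat_log_series (?e - mat 1) = A"
  proof (rule mat_exp_inj)
    show "mat_exp (mat_log_series (?e - mat 1)) = ?e"
      using mat_exp_log_series[of "?e - mat 1"] d by (simp add: A_def)
  qed (use a e in \<open>simp_all add: A_def\<close>)
  have "series_chart \<iota> ?U = stack_blocks \<iota> A (B ** S ** P)"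
    by (simp add: series_chart_def polar log gd Psq low)
  also have "B ** S ** P = B" by (simp add: matrix_mul_assoc[symmetric] SP)
  finally show "series_chart \<iota> ?U = x" by (simp add: A_def B_def \<iota>)
qed

section \<open>Smoothness of the chart and of its inverse\<close>

lemma continuous_on_operator_norm: "continuous_on S operator_norm"
  unfolding operator_norm_def
  by (intro continuous_on_norm linear_continuous_on bounded_linear_endo_of_matrix)

lemma open_operator_norm_less:
  assumes "open S" "continuous_on S f"
  shows "open {x \<in> S. operator_norm (f x :: real^'p^'p) < c}"
proof -
  have "continuous_on S (\<lambda>x. operator_norm (f x))"
    using continuous_on_compose2[OF continuous_on_operator_norm[of UNIV] assms(2)] by simp
  then have "open (S \<inter> (\<lambda>x. operator_norm (f x)) -` {..<c})"
    by (rule continuous_open_preimage[OF _ assms(1) open_lessThan])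
  also have "S \<inter> (\<lambda>x. operator_norm (f x)) -` {..<c} = {x \<in> S. operator_norm (f x) < c}" by auto
  finally show ?thesis .
qed

lemma Ck_on_matrix_power_series:
  assumes "converges_below K c"
  shows "Ck_on k {Y :: real^'p^'p. operator_norm Y < K} (\<lambda>Y. matrix_of_endo (power_series c (endo_of_matrix Y)))"
  unfolding operator_norm_def
  by (rule Ck_on_power_series[OF bounded_linear_endo_of_matrix bounded_linear_matrix_of_endo assms])

lemma Ck_on_mat_binomial: "Ck_on k {Y :: real^'p^'p. operator_norm Y < 1} (mat_binomial a)"
  unfolding mat_binomial_def[abs_def] binomial_series_def
  by (rule Ck_on_matrix_power_series[OF converges_below_gbinomial])

lemma Ck_on_mat_log_series: "Ck_on k {Y :: real^'p^'p. operator_norm Y < 1} mat_log_series"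
  unfolding mat_log_series_def[abs_def] log_series_def
  by (rule Ck_on_matrix_power_series[OF converges_below_log])

lemma Ck_on_mat_exp: "Ck_on k {Y :: real^'p^'p. operator_norm Y < 1} mat_exp"
  unfolding mat_exp_eq[abs_def] exp_power_series
  by (rule Ck_on_matrix_power_series[OF converges_below_exp])

lemmas Ck_on_matrix_mult = Ck_on_bounded_bilinear[OF bounded_bilinear_matrix_mult]

lemma Ck_on_linear: "open S \<Longrightarrow> linear f \<Longrightarrow> Ck_on k S f"
  for f :: "'a::euclidean_space \<Rightarrow> 'b::euclidean_space"
  by (rule Ck_on_bounded_linear) (simp add: linear_conv_bounded_linear)

lemma Ck_on_diff_const:
  assumes "open S" "Ck_on k S f"
  shows "Ck_on k S (\<lambda>x. f x - c)"
  using Ck_on_add[OF assms Ck_on_const[OF assms(1), of k "- c"]] by simp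

lemma Ck_on_transpose:
  assumes "open S" "Ck_on k S f"
  shows "Ck_on k S (\<lambda>x. transpose (f x :: real^'a^'b))"
  by (rule Ck_on_compose_bounded_linear[OF _ assms]) (simp add: linear_conv_bounded_linear[symmetric] linear_transpose)

lemma Ck_on_stack_blocks:
  fixes f :: "'a::euclidean_space \<Rightarrow> real^'p^'p" and g :: "'a \<Rightarrow> real^'p^'n"
  assumes "open S" "Ck_on k S f" "Ck_on k S g"
  shows "Ck_on k S (\<lambda>x. stack_blocks \<iota> (f x) (g x))"
proof -
  have split: "stack_blocks \<iota> A B = stack_blocks \<iota> A 0 + stack_blocks \<iota> 0 B" for A :: "real^'p^'p" and B :: "real^'p^'n"
    by (simp add: stack_blocks_def vec_eq_iff)
  have "Ck_on k S (\<lambda>x. stack_blocks \<iota> (f x) 0 + stack_blocks \<iota> 0 (g x))"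
    using linear_stack_blocks
    by (intro Ck_on_add[OF assms(1)] Ck_on_compose_bounded_linear[OF _ assms(1,2)]
          Ck_on_compose_bounded_linear[OF _ assms(1,3)])
       (simp_all only: linear_conv_bounded_linear)
  then show ?thesis by (subst split)
qed

lemmas Ck_on_blocks = Ck_on_linear[OF _ linear_upper_block] Ck_on_linear[OF _ linear_lower_block]

lemma Ck_on_gram_defect: "open S \<Longrightarrow> Ck_on k S (gram_defect \<iota>)"
  unfolding gram_defect_def[abs_def]
  by (intro Ck_on_diff_const Ck_on_matrix_mult Ck_on_transpose Ck_on_blocks)

lemma Ck_on_lower_gram: "open S \<Longrightarrow> Ck_on k S (lower_gram \<iota>)"
  unfolding lower_gram_def[abs_def]
  by (intro Ck_on_matrix_mult Ck_on_transpose Ck_on_blocks)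

lemma open_gram_defect: "open {U. operator_norm (gram_defect \<iota> U) < 1}"
  using open_operator_norm_less[OF open_UNIV Ck_on_continuous_on[OF Ck_on_gram_defect[OF open_UNIV]]] by simp

lemma open_lower_gram: "open {x. operator_norm (lower_gram \<iota> x) < 1}"
  using open_operator_norm_less[OF open_UNIV Ck_on_continuous_on[OF Ck_on_lower_gram[OF open_UNIV]]] by simp

lemma Ck_on_polar_factor: "Ck_on k {U. operator_norm (gram_defect \<iota> U) < 1} (polar_factor \<iota>)"
  unfolding polar_factor_def[abs_def]
  by (intro Ck_on_matrix_mult Ck_on_blocks open_gram_defect
      Ck_on_compose[OF open_gram_defect Ck_on_gram_defect[OF open_gram_defect] Ck_on_mat_binomial]) auto

lemma open_series_domain: "open (series_domain \<iota>)"
proof -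
  have "series_domain \<iota> = {U \<in> {U. operator_norm (gram_defect \<iota> U) < 1}. operator_norm (polar_factor \<iota> U - mat 1) < 1}"
    by (auto simp: series_domain_def)
  also have "open \<dots>"
    by (rule open_operator_norm_less[OF open_gram_defect
          Ck_on_continuous_on[OF Ck_on_diff_const[OF open_gram_defect Ck_on_polar_factor]]])
  finally show ?thesis .
qed

lemma Ck_on_series_chart: "Ck_on k (series_domain \<iota>) (series_chart \<iota>)"
proof -
  note o = open_series_domain[of \<iota>]
  have sub: "series_domain \<iota> \<subseteq> {U. operator_norm (gram_defect \<iota> U) < 1}"
    by (auto simp: series_domain_def)
  show ?thesis
    unfolding series_chart_def[abs_def]
    by (intro Ck_on_stack_blocks Ck_on_matrix_mult Ck_on_blocks o
        Ck_on_compose[OF o Ck_on_gram_defect[OF o] Ck_on_mat_binomial]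
        Ck_on_compose[OF o Ck_on_diff_const[OF o Ck_on_subset[OF Ck_on_polar_factor sub]] Ck_on_mat_log_series])
       (auto simp: series_domain_def)
qed

lemma Ck_on_inverse_chart:
  assumes "open S" and "\<And>x. x \<in> S \<Longrightarrow> operator_norm (upper_block \<iota> x) < 1"
    and "\<And>x. x \<in> S \<Longrightarrow> operator_norm (lower_gram \<iota> x) < 1"
  shows "Ck_on k S (inverse_chart \<iota>)"
  unfolding inverse_chart_def[abs_def]
  by (intro Ck_on_stack_blocks Ck_on_matrix_mult Ck_on_blocks assms(1)
      Ck_on_compose[OF assms(1) Ck_on_blocks(1)[OF assms(1)] Ck_on_mat_exp]
      Ck_on_compose[OF assms(1) Ck_on_lower_gram[OF assms(1)] Ck_on_mat_binomial])
     (use assms in auto)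

lemma operator_norm_0 [simp]: "operator_norm 0 = 0"
  by (simp add: operator_norm_def linear_0[OF linear_endo_of_matrix])

text \<open>Each condition describes an open set that contains \<open>0\<close>, provided that the earlier conditions make
  the functions in it continuous. The order of the sets below reflects this.\<close>

lemma admissible_radius:
  fixes \<iota> :: "'p::finite \<Rightarrow> 'n::finite"
  obtains \<epsilon> where "\<epsilon> > 0"
    "\<And>x. x \<in> ball 0 \<epsilon> \<Longrightarrow> operator_norm (upper_block \<iota> x) < 1/2"
    "\<And>x. x \<in> ball 0 \<epsilon> \<Longrightarrow> operator_norm (lower_gram \<iota> x) < 1"
    "\<And>x. x \<in> ball 0 \<epsilon> \<Longrightarrow> operator_norm (mat_binomial (- 1) (lower_gram \<iota> x) - mat 1) < 1"
    "\<And>x. x \<in> ball 0 \<epsilon> \<Longrightarrow> operator_norm (mat_exp (upper_block \<iota> x) - mat 1) < 1"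
    "\<And>x. x \<in> ball 0 \<epsilon> \<Longrightarrow> operator_norm (mat_log_series (mat_exp (upper_block \<iota> x) - mat 1)) < 1/2"
proof -
  let ?u = "upper_block \<iota> :: real^'p^'n \<Rightarrow> _"
  define S0 where "S0 = {x. operator_norm (lower_gram \<iota> x) < 1}"
  define S1 where "S1 = {x \<in> S0. operator_norm (?u x) < 1/2}"
  define S2 where "S2 = {x \<in> S1. operator_norm (mat_binomial (- 1) (lower_gram \<iota> x) - mat 1) < 1}"
  define S3 where "S3 = {x \<in> S2. operator_norm (mat_exp (?u x) - mat 1) < 1}"
  define S4 where "S4 = {x \<in> S3. operator_norm (mat_log_series (mat_exp (?u x) - mat 1)) < 1/2}"
  have "open S0" unfolding S0_def by (rule open_lower_gram)
  then have o1: "open S1" unfolding S1_def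
    by (intro open_operator_norm_less Ck_on_continuous_on[OF Ck_on_blocks(1)])
  have "Ck_on k S1 (\<lambda>x. mat_binomial (- 1) (lower_gram \<iota> x))" for k
    by (rule Ck_on_compose[OF o1 Ck_on_lower_gram[OF o1] Ck_on_mat_binomial]) (auto simp: S1_def S0_def)
  then have o2: "open S2" unfolding S2_def
    by (intro open_operator_norm_less o1 Ck_on_continuous_on[OF Ck_on_diff_const[OF o1]])
  have exp: "Ck_on k S2 (\<lambda>x. mat_exp (?u x) - mat 1)" for k
    by (intro Ck_on_diff_const o2 Ck_on_compose[OF o2 Ck_on_blocks(1)[OF o2] Ck_on_mat_exp])
       (auto simp: S2_def S1_def)
  then have o3: "open S3" unfolding S3_def
    by (intro open_operator_norm_less o2 Ck_on_continuous_on)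
  have "Ck_on k S3 (\<lambda>x. mat_log_series (mat_exp (?u x) - mat 1))" for k
    by (rule Ck_on_compose[OF o3 Ck_on_subset[OF exp] Ck_on_mat_log_series]) (auto simp: S3_def)
  then have o4: "open S4" unfolding S4_def
    by (intro open_operator_norm_less o3 Ck_on_continuous_on)
  have "?u 0 = 0" "lower_gram \<iota> (0 :: real^'p^'n) = 0"
    by (simp_all add: linear_0[OF linear_upper_block] lower_gram_def linear_0[OF linear_lower_block])
  then have "0 \<in> S4" unfolding S4_def S3_def S2_def S1_def S0_def by simp
  with o4 obtain \<epsilon> where "\<epsilon> > 0" "ball 0 \<epsilon> \<subseteq> S4" by (rule openE)
  then show ?thesis
    by (intro that[of \<epsilon>]) (auto simp: S4_def S3_def S2_def S1_def S0_def subset_iff)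
qed

theorem lemma3p1:
  fixes \<iota> :: "'p::finite \<Rightarrow> 'n::finite"
  assumes "inj \<iota>"
  shows "dim (tangent_space_E \<iota>) =
           CARD('p) * (CARD('p) - 1) div 2 + (CARD('n) - CARD('p)) * CARD('p) \<and>
         (\<exists>B. openin (top_of_set stiefel) B \<and> base_point \<iota> \<in> B \<and> path_connected B \<and>
              (\<forall>U\<in>B. psi_E_defined \<iota> U) \<and>
              coordinate_chart stiefel (tangent_space_E \<iota>) B (psi_E \<iota>))"
proof (intro conjI)
  show "dim (tangent_space_E \<iota>) =
           CARD('p) * (CARD('p) - 1) div 2 + (CARD('n) - CARD('p)) * CARD('p)"
    by (rule dim_tangent_space_E[OF assms])
  obtain \<epsilon> where \<epsilon>: "\<epsilon> > 0"
    "\<And>x. x \<in> ball 0 \<epsilon> \<Longrightarrow> operator_norm (upper_block \<iota> x) < 1/2"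
    "\<And>x. x \<in> ball 0 \<epsilon> \<Longrightarrow> operator_norm (lower_gram \<iota> x) < 1"
    "\<And>x. x \<in> ball 0 \<epsilon> \<Longrightarrow> operator_norm (mat_binomial (- 1) (lower_gram \<iota> x) - mat 1) < 1"
    "\<And>x. x \<in> ball 0 \<epsilon> \<Longrightarrow> operator_norm (mat_exp (upper_block \<iota> x) - mat 1) < 1"
    "\<And>x. x \<in> ball 0 \<epsilon> \<Longrightarrow> operator_norm (mat_log_series (mat_exp (upper_block \<iota> x) - mat 1)) < 1/2"
    by (rule admissible_radius[of \<iota>]) (rule that)
  let ?T = "tangent_space_E \<iota>" and ?D = "tangent_space_E \<iota> \<inter> ball 0 \<epsilon>"
  (* On the open set W the extended chart is defined and takes values in the ball, so its points on
     the Stiefel manifold are exactly the images of ?D under the inverse chart. *)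
  define W where "W = series_domain \<iota> \<inter> series_chart \<iota> -` ball 0 \<epsilon>"
  define B where "B = stiefel \<inter> W"
  have "open W"
    unfolding W_def
    by (rule continuous_open_preimage[OF Ck_on_continuous_on[OF Ck_on_series_chart] open_series_domain open_ball])
  have chart: "psi_E_defined \<iota> U" "psi_E \<iota> U = series_chart \<iota> U" "series_chart \<iota> U \<in> ?D"
    "inverse_chart \<iota> (series_chart \<iota> U) = U" if "U \<in> B" for U
  proof -
    have "U \<in> stiefel" "U \<in> series_domain \<iota>" and "series_chart \<iota> U \<in> ball 0 \<epsilon>"
      using that by (auto simp: B_def W_def)
    note c = series_chart_correct[OF assms this(1,2) \<epsilon>(2,3)[OF this(3)]]
    show "psi_E_defined \<iota> U" "psi_E \<iota> U = series_chart \<iota> U" "inverse_chart \<iota> (series_chart \<iota> U) = U"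
      by (rule c)+
    show "series_chart \<iota> U \<in> ?D" using c(3) \<open>series_chart \<iota> U \<in> ball 0 \<epsilon>\<close> by blast
  qed
  have inv: "inverse_chart \<iota> x \<in> B" "psi_E \<iota> (inverse_chart \<iota> x) = x" if "x \<in> ?D" for x
  proof -
    from that have "x \<in> ?T" "x \<in> ball 0 \<epsilon>" by auto
    note c = inverse_chart_correct[OF assms this(1) \<epsilon>(2-6)[OF this(2)]]
    show "inverse_chart \<iota> x \<in> B" using c \<open>x \<in> ball 0 \<epsilon>\<close> by (simp add: B_def W_def)
    then show "psi_E \<iota> (inverse_chart \<iota> x) = x" by (simp add: chart(2) c(3))
  qed
  have image: "psi_E \<iota> ` B = ?D"
  proof
    show "psi_E \<iota> ` B \<subseteq> ?D" using chart(2,3) by auto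
    show "?D \<subseteq> psi_E \<iota> ` B"
    proof
      fix x assume "x \<in> ?D"
      from inv[OF this] show "x \<in> psi_E \<iota> ` B" by (intro image_eqI[of x _ "inverse_chart \<iota> x"]) auto
    qed
  qed
  have inj: "inj_on (psi_E \<iota>) B"
    by (rule inj_on_inverseI[of _ "inverse_chart \<iota>"]) (simp add: chart(2,4))
  have smooth_inv: "Ck_on k (ball 0 \<epsilon>) (inverse_chart \<iota>)" for k
  proof (rule Ck_on_inverse_chart[OF open_ball])
    show "operator_norm (upper_block \<iota> x) < 1" if "x \<in> ball 0 \<epsilon>" for x
      using \<epsilon>(2)[OF that] by simp
  qed (rule \<epsilon>(3))
  have B_image: "B = inverse_chart \<iota> ` ?D"
  proof
    show "inverse_chart \<iota> ` ?D \<subseteq> B" using inv(1) by auto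
    show "B \<subseteq> inverse_chart \<iota> ` ?D"
    proof
      fix U assume "U \<in> B"
      from chart(3,4)[OF this] show "U \<in> inverse_chart \<iota> ` ?D"
        by (intro image_eqI[of U _ "series_chart \<iota> U"]) auto
    qed
  qed
  have "path_connected B"
    unfolding B_image
  proof (rule path_connected_continuous_image)
    show "continuous_on ?D (inverse_chart \<iota>)"
      by (rule continuous_on_subset[OF Ck_on_continuous_on[OF smooth_inv]]) auto
    show "path_connected ?D"
      by (intro convex_imp_path_connected convex_Int subspace_imp_convex subspace_tangent_space_E[OF assms] convex_ball)
  qed
  moreover have "base_point \<iota> \<in> B"
  proof -
    have "inverse_chart \<iota> 0 = base_point \<iota>"
      by (simp add: inverse_chart_def base_point_def lower_gram_def linear_0[OF linear_upper_block] linear_0[OF linear_lower_block])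
    moreover have "0 \<in> ?D" using \<epsilon>(1) subspace_0[OF subspace_tangent_space_E[OF assms]] by simp
    ultimately show ?thesis using inv(1)[of 0] by simp
  qed
  moreover have "openin (top_of_set stiefel) B"
    unfolding B_def using \<open>open W\<close> by (rule openin_open_Int)
  moreover have "coordinate_chart stiefel ?T B (psi_E \<iota>)"
    unfolding coordinate_chart_def
  proof (intro conjI)
    show "openin (top_of_set stiefel) B" by fact
    show "subspace ?T" by (rule subspace_tangent_space_E[OF assms])
    show "openin (top_of_set ?T) (psi_E \<iota> ` B)"
      unfolding image by (rule openin_open_Int[OF open_ball])
    show "inj_on (psi_E \<iota>) B" by (rule inj)
    show "smooth_map_on B (psi_E \<iota>)"
      unfolding smooth_map_on_def
    proof
      fix U assume "U \<in> B"
      show "\<exists>W g. open W \<and> U \<in> W \<and> (\<forall>k. Ck_on k W g) \<and> (\<forall>y\<in>B \<inter> W. g y = psi_E \<iota> y)"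
      proof (intro exI conjI allI ballI)
        show "open W" by fact
        show "U \<in> W" using \<open>U \<in> B\<close> by (simp add: B_def)
        show "Ck_on k W (series_chart \<iota>)" for k
          by (rule Ck_on_subset[OF Ck_on_series_chart]) (simp add: W_def)
        show "series_chart \<iota> y = psi_E \<iota> y" if "y \<in> B \<inter> W" for y
          using that by (simp add: chart(2))
      qed
    qed
    show "smooth_map_on (psi_E \<iota> ` B) (inv_into B (psi_E \<iota>))"
      unfolding smooth_map_on_def image
    proof
      fix x assume "x \<in> ?D"
      show "\<exists>W g. open W \<and> x \<in> W \<and> (\<forall>k. Ck_on k W g) \<and> (\<forall>y\<in>?D \<inter> W. g y = inv_into B (psi_E \<iota>) y)"
      proof (intro exI conjI allI ballI)
        show "open (ball 0 \<epsilon>)" by (rule open_ball)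
        show "x \<in> ball 0 \<epsilon>" using \<open>x \<in> ?D\<close> by blast
        show "Ck_on k (ball 0 \<epsilon>) (inverse_chart \<iota>)" for k by (rule smooth_inv)
        show "inverse_chart \<iota> y = inv_into B (psi_E \<iota>) y" if "y \<in> ?D \<inter> ball 0 \<epsilon>" for y
          using inv_into_f_eq[OF inj inv[of y]] that by simp
      qed
    qed
  qed
  ultimately show "\<exists>B. openin (top_of_set stiefel) B \<and> base_point \<iota> \<in> B \<and> path_connected B \<and>
              (\<forall>U\<in>B. psi_E_defined \<iota> U) \<and>
              coordinate_chart stiefel (tangent_space_E \<iota>) B (psi_E \<iota>)"
    using chart(1) by blast
qed

end
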